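(* As $t\to\infty$ ($t>0$), the rescaled distribution $\mu_t(\sqrt t\,\cdot)$, i.e. the push-forward of $\mu_t$ under $z\mapsto z/\sqrt t$, converges weakly to the standard semicircle distribution $\mathsf{sc}_1$.
   Context: $d\in\mathbb{N}$, $\lambda_1,\dots,\lambda_d\in\mathbb{C}$ are distinct, $\alpha_1,\dots,\alpha_d\in\mathbb{N}=\{1,2,\dots\}$, $\alpha=\sum_j\alpha_j$, $P(z)=\prod_{j=1}^d(z-\lambda_j)^{\alpha_j}$, $P^n$ is the $n$-th power of $P$, and $P_t^n=e^{-\frac{t}{2\alpha n}\partial_z^2}P^n=\sum_{k\ge0}\frac{1}{k!}(-\frac{t}{2\alpha n})^k\partial_z^{2k}P^n$. For $t>0$, $\mu_t$ is the weak limit as $n\to\infty$ of $\mu_{n,t}=\frac1{\alpha n}\sum_{\lambda:P_t^n(\lambda)=0}\delta_\lambda$ (zeros counted with multiplicity); this limit exists and is a compactly supported probability measure on $\mathbb{C}$. $\mathsf{sc}_1$ has density $x\mapsto\frac1{2\pi}\sqrt{4-x^2}$ on $[-2,2]\subset\mathbb{R}$ and is viewed as a probability measure on $\mathbb{C}$. *)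

theory Defs
  imports "HOL-Probability.Probability" "HOL-Computational_Algebra.Polynomial"
begin

text \<open>
  The operator \<open>exp (c \<partial>\<^sup>2) = (\<Sum>k\<ge>0. c ^ k / k! \<partial> ^ (2 * k))\<close> on polynomials. The summands with
  \<open>2 * k > degree p\<close> vanish, so the series is cut off at \<open>k = degree p\<close>; the lemma below states
  that any later cut-off gives the same polynomial.
\<close>

definition exp_deriv2 :: "complex \<Rightarrow> complex poly \<Rightarrow> complex poly" where
  "exp_deriv2 c p = (\<Sum>k\<le>degree p. smult (c ^ k / fact k) ((pderiv ^^ (2 * k)) p))"

lemma exp_deriv2_eq_sum:
  assumes "degree p \<le> N"
  shows "exp_deriv2 c p = (\<Sum>k\<le>N. smult (c ^ k / fact k) ((pderiv ^^ (2 * k)) p))"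
proof -
  have deg: "degree ((pderiv ^^ m) p) = degree p - m" for m
    by (induction m) (auto simp: degree_pderiv)
  have "(pderiv ^^ (2 * k)) p = 0" if "degree p < k" for k
  proof -
    have "degree ((pderiv ^^ (2 * k - 1)) p) = 0"
      using that by (simp add: deg)
    then have "pderiv ((pderiv ^^ (2 * k - 1)) p) = 0"
      by (simp add: pderiv_eq_0_iff)
    then have "(pderiv ^^ Suc (2 * k - 1)) p = 0"
      by simp
    moreover have "Suc (2 * k - 1) = 2 * k"
      using that by simp
    ultimately show ?thesis
      by metis
  qed
  then show ?thesis
    unfolding exp_deriv2_def using assms by (intro sum.mono_neutral_left) auto
qed

text \<open>
  The measure \<open>1 / N\<close> times the sum of the Dirac masses at the zeros of \<open>p\<close>, every zero being
  counted with its multiplicity \<open>order z p\<close>. Pushing forward along the identity replaces the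
  discrete sigma algebra of \<^const>\<open>point_measure\<close> by the Borel one.
\<close>

definition zero_measure :: "nat \<Rightarrow> complex poly \<Rightarrow> complex measure" where
  "zero_measure N p =
     distr (point_measure {z. poly p z = 0} (\<lambda>z. ennreal (real (order z p) / real N)))
       borel (\<lambda>z. z)"

definition base_poly :: "nat \<Rightarrow> (nat \<Rightarrow> complex) \<Rightarrow> (nat \<Rightarrow> nat) \<Rightarrow> complex poly" where
  "base_poly d lam \<alpha> = (\<Prod>j=1..d. [:- lam j, 1:] ^ \<alpha> j)"

definition heat_poly ::
    "nat \<Rightarrow> (nat \<Rightarrow> complex) \<Rightarrow> (nat \<Rightarrow> nat) \<Rightarrow> nat \<Rightarrow> real \<Rightarrow> complex poly" where
  "heat_poly d lam \<alpha> n t =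
     exp_deriv2 (- complex_of_real (t / (2 * real (\<Sum>j=1..d. \<alpha> j) * real n)))
       (base_poly d lam \<alpha> ^ n)"

text \<open>
  For \<open>n = 0\<close> the next measure is null, as the polynomial is constant; only the limit
  \<open>n \<longlonglongrightarrow> \<infinity>\<close> is of interest.
\<close>

definition heat_zero_measure ::
    "nat \<Rightarrow> (nat \<Rightarrow> complex) \<Rightarrow> (nat \<Rightarrow> nat) \<Rightarrow> nat \<Rightarrow> real \<Rightarrow> complex measure" where
  "heat_zero_measure d lam \<alpha> n t =
     zero_measure ((\<Sum>j=1..d. \<alpha> j) * n) (heat_poly d lam \<alpha> n t)"

text \<open>
  Weak convergence along a filter, by bounded continuous test functions. The library's
  \<^const>\<open>weak_conv_m\<close> covers only sequences of measures on the real line.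
\<close>

definition weakly_converges ::
    "('i \<Rightarrow> 'a::topological_space measure) \<Rightarrow> 'a measure \<Rightarrow> 'i filter \<Rightarrow> bool" where
  "weakly_converges M L F \<longleftrightarrow>
     (\<forall>f::'a \<Rightarrow> real. continuous_on UNIV f \<and> bounded (range f) \<longrightarrow>
        ((\<lambda>i. \<integral>x. f x \<partial>M i) \<longlongrightarrow> (\<integral>x. f x \<partial>L)) F)"

definition semicircle :: "complex measure" where
  "semicircle =
     distr (density lborel (\<lambda>x. ennreal (indicator {-2..2} x * (sqrt (4 - x\<^sup>2) / (2 * pi)))))
       borel complex_of_real"

end

theory Submission
  imports Defs "HOL-Computational_Algebra.Polynomial_FPS"
    "HOL-Computational_Algebra.Fundamental_Theorem_Algebra"
begin

text \<open>
  Under the heat flow the logarithmic derivative of a polynomial of degree \<open>N\<close> solves a viscous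
  Burgers equation. Read off at infinity, it says that the normalised power sums
  \<open>m\<^sub>k\<close> of the zeros satisfy
  \<open>m\<^sub>k' = k / 2 (\<Sum>a + b = k - 2. m\<^sub>a m\<^sub>b - (k - 1) / N m\<^sub>k\<^sub>-\<^sub>2)\<close>, so that they are polynomials in
      \<open>t\<close> of degree
  at most \<open>k / 2\<close> with coefficients continuous in \<open>1 / N\<close>. After letting \<open>N \<rightarrow> \<infinity>\<close>
  and rescaling, only the coefficient of \<open>t ^ (k / 2)\<close> survives as \<open>t \<rightarrow> \<infinity>\<close>; it is a
  Catalan number, that is, the \<open>k\<close>-th moment of the semicircle law.

  Complex moments do not determine a measure on the plane, but the flow keeps all zeros in a fixed
  horizontal strip, which the rescaling shrinks to the real axis, and there the method of moments
  applies.
\<close>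

subsection \<open>Evolution of power sums\<close>

text \<open>Zeros may collide, so they are not followed individually. Everything is read off the
  reversed polynomial \<open>R = \<Prod> (1 - z i * X)\<close>, whose coefficients are polynomials
  in \<open>t\<close>: the series \<open>V\<close> with \<open>V * R = N * R - X * R'\<close>
  generates the power sums, and the Burgers equation becomes an identity between formal power series
  over the polynomial ring in \<open>t\<close>. Setting \<open>t = 0\<close> gives the initial power
  sums, any other value those of the evolved zeros.

  Weak convergence to \<open>\<mu> t\<close> says nothing about integrals of the unbounded functions
  \<open>z ^ k\<close>. The moment argument is therefore run on the zeros at finite
  \<open>n\<close>, in a quantitative form whose tolerance and number of moments depend on the limit
  law, the test function and the accuracy, but not on the atoms. For large fixed \<open>t\<close> it
  applies to all large \<open>n\<close>, and then only the integral of a bounded test function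
  passes to the limit.\<close>

definition euler_deriv :: "'a::comm_ring_1 fps \<Rightarrow> 'a fps" where
  "euler_deriv F = fps_X * fps_deriv F"

lemma fps_nth_euler_deriv [simp]: "fps_nth (euler_deriv F) n = of_nat n * fps_nth F n"
  by (cases n) (simp_all add: euler_deriv_def)

lemma euler_deriv_mult: "euler_deriv (F * G) = euler_deriv F * G + F * euler_deriv G"
  by (simp add: euler_deriv_def algebra_simps)

lemma euler_deriv_uminus: "euler_deriv (- G) = - euler_deriv G"
  by (simp add: euler_deriv_def)

lemma euler_deriv_of_nat [simp]: "euler_deriv (of_nat n) = 0"
  by (simp add: euler_deriv_def)

lemma euler_deriv_1 [simp]: "euler_deriv 1 = 0"
  by (simp add: euler_deriv_def)

text \<open>The time derivative: the coefficient polynomials have the variable \<open>t\<close>, the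
  series has the reciprocal of the space variable.\<close>

definition coeff_deriv :: "'a::idom poly fps \<Rightarrow> 'a poly fps" where
  "coeff_deriv F = Abs_fps (\<lambda>n. pderiv (fps_nth F n))"

lemma fps_nth_coeff_deriv [simp]: "fps_nth (coeff_deriv F) n = pderiv (fps_nth F n)"
  by (simp add: coeff_deriv_def)

lemma coeff_deriv_mult: "coeff_deriv (F * G) = coeff_deriv F * G + F * coeff_deriv G"
  by (rule fps_ext)
    (simp add: fps_mult_nth higher_pderiv_sum[of 1, simplified] pderiv_mult sum.distrib,
      simp add: mult.commute add.commute)

lemma coeff_deriv_diff: "coeff_deriv (F - G) = coeff_deriv F - coeff_deriv G"
  by (rule fps_ext) (simp add: pderiv_diff)

lemma pderiv_of_nat [simp]: "pderiv (of_nat n) = 0"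
  by (induction n) (simp_all add: pderiv_add)

lemma coeff_deriv_of_nat_mult: "coeff_deriv (of_nat n * F) = of_nat n * coeff_deriv F"
  by (rule fps_ext) (simp add: fps_of_nat[symmetric] pderiv_mult del: fps_of_nat)

lemma coeff_deriv_of_nat [simp]: "coeff_deriv (of_nat n) = 0"
  by (rule fps_ext) (simp add: fps_of_nat[symmetric] del: fps_of_nat)

lemma coeff_deriv_euler_deriv: "coeff_deriv (euler_deriv F) = euler_deriv (coeff_deriv F)"
  by (rule fps_ext) (simp add: pderiv_mult)

text \<open>On reversed polynomials \<open>N - X d/dX\<close> acts as \<open>z d/dz\<close> does on
  the original ones, and \<open>fps_X ^ 2\<close> stands for \<open>1 / z ^ 2\<close>; so
  \<open>heat\<close> is the heat equation with \<open>z ^ 2 p''\<close> written as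
  \<open>(z d/dz - 1) (z d/dz) p\<close>. It says that \<open>log R\<close> has time derivative
  \<open>- L / (2 N)\<close>, and \<open>V = N - euler_deriv (log R)\<close> turns this into the
  claim. Everything is kept multiplied by \<open>R\<close>, which is cancelled at the end, so no
  logarithm or quotient is formed.\<close>

lemma heat_flow_log_deriv:
  fixes R V :: "'a::idom poly fps"
  assumes V: "V * R = of_nat N * R - euler_deriv R"
    and heat: "2 * of_nat N * coeff_deriv R =
      - (fps_X ^ 2 * (let S = of_nat N * R - euler_deriv R in of_nat N * S - S - euler_deriv S))"
    and "R \<noteq> 0"
  shows "2 * of_nat N * coeff_deriv V = euler_deriv (fps_X ^ 2 * (V * V - V - euler_deriv V))"
proof -
  define L where "L = fps_X ^ 2 * (V * V - V - euler_deriv V)"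
  define n where "n = (of_nat N :: 'a poly fps)"
  have eR: "euler_deriv R = n * R - V * R"
    using V by (simp add: n_def)
  have "n * (V * R) - V * R - euler_deriv (V * R) = (V * V - V - euler_deriv V) * R"
    by (simp add: euler_deriv_mult eR algebra_simps)
  then have LR: "2 * n * coeff_deriv R = - (L * R)"
    using heat V by (simp add: L_def n_def Let_def mult.assoc)
  have "coeff_deriv (V * R) = coeff_deriv (n * R - euler_deriv R)"
    using V by (simp add: n_def)
  then have *: "coeff_deriv V * R + V * coeff_deriv R
      = n * coeff_deriv R - euler_deriv (coeff_deriv R)"
    by (simp add: coeff_deriv_mult coeff_deriv_diff n_def coeff_deriv_of_nat_mult
      coeff_deriv_euler_deriv)
  have "2 * n * coeff_deriv V * R + V * (2 * n * coeff_deriv R)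
      = 2 * n * (coeff_deriv V * R + V * coeff_deriv R)"
    by (simp add: algebra_simps)
  also have "\<dots> = n * (2 * n * coeff_deriv R) - 2 * n * euler_deriv (coeff_deriv R)"
    unfolding * by (simp add: algebra_simps)
  also have "2 * n * euler_deriv (coeff_deriv R) = euler_deriv (2 * n * coeff_deriv R)"
  proof -
    have "2 * n = of_nat (2 * N)"
      by (simp add: n_def)
    then show ?thesis
      by (metis add_cancel_left_left euler_deriv_mult euler_deriv_of_nat mult_zero_left)
  qed
  finally have "2 * n * coeff_deriv V * R + V * (- (L * R))
      = n * (- (L * R)) - euler_deriv (- (L * R))"
    unfolding LR .
  then have "2 * n * coeff_deriv V * R = euler_deriv L * R"
    by (simp add: euler_deriv_uminus euler_deriv_mult eR algebra_simps)
  then show ?thesis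
    using \<open>R \<noteq> 0\<close> by (simp add: L_def n_def)
qed

section \<open>The recursion for the moments in powers of time\<close>

text \<open>
  Coefficient of \<open>t ^ i\<close> in the \<open>k\<close>-th moment of the zeros at time \<open>t\<close>; here \<open>m\<close> is the moment
  sequence at time \<open>0\<close> and \<open>h\<close> is the reciprocal of the number of zeros.
\<close>

fun moment_coeff :: "(nat \<Rightarrow> complex) \<Rightarrow> complex \<Rightarrow> nat \<Rightarrow> nat \<Rightarrow> complex" where
  "moment_coeff m h k 0 = m k"
| "moment_coeff m h k (Suc i) = (if k < 2 then 0 else of_nat k / (2 * of_nat (Suc i)) *
     ((\<Sum>a\<le>k - 2. \<Sum>j\<le>i. moment_coeff m h a j * moment_coeff m h (k - 2 - a) (i - j))
       - of_nat (k - 1) * h * moment_coeff m h (k - 2) i))"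

text \<open>Parabolic scaling: the \<open>k\<close>-th moment has weight \<open>k\<close> and time
  has weight 2. In each product of the recursion the weights add up to \<open>k - 2\<close>, so if
  \<open>k < 2 * Suc l\<close> one of the two factors has too small a weight for its power of
  \<open>t\<close>.\<close>

lemma moment_coeff_eq_0: "k < 2 * i \<Longrightarrow> moment_coeff m h k i = 0"
proof (induction i arbitrary: k rule: less_induct)
  case (less i)
  show ?case
  proof (cases "i = 0 \<or> k < 2")
    case True
    then show ?thesis
      using less.prems by (cases i) auto
  next
    case False
    then obtain l where i: "i = Suc l"
      by (cases i) auto
    have *: "moment_coeff m h a j * moment_coeff m h (k - 2 - a) (l - j) = 0"
      if "a \<le> k - 2" "j \<le> l" for a j
    proof -
      have "a < 2 * j \<or> k - 2 - a < 2 * (l - j)"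
        using less.prems that False i by auto
      then show ?thesis
        using less.IH[of j a] less.IH[of "l - j" "k - 2 - a"] that i diff_less_Suc[of l j]
            le_imp_less_Suc
        by (metis mult_eq_0_iff)
    qed
    have "(\<Sum>a\<le>k - 2. \<Sum>j\<le>l. moment_coeff m h a j * moment_coeff m h (k - 2 - a) (l - j)) = 0"
      by (intro sum.neutral ballI *) auto
    moreover have "moment_coeff m h (k - 2) l = 0"
      using less.IH[of l "k - 2"] less.prems False i by auto
    ultimately show ?thesis
      by (simp add: i)
  qed
qed

lemma tendsto_moment_coeff:
  assumes "(h \<longlongrightarrow> h0) F"
  shows "((\<lambda>x. moment_coeff m (h x) k i) \<longlongrightarrow> moment_coeff m h0 k i) F"
proof (induction i arbitrary: k rule: less_induct)
  case (less i)
  show ?case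
  proof (cases i)
    case (Suc l)
    have "((\<lambda>x. moment_coeff m (h x) a j) \<longlongrightarrow> moment_coeff m h0 a j) F" if "j \<le> l" for a j
      using less.IH[of j a] that Suc by auto
    then show ?thesis
      using assms by (auto simp: Suc simp del: of_nat_Suc intro!: tendsto_intros)
  qed simp
qed

text \<open>Only products with \<open>a = 2 * j\<close> have both factors on the diagonal; in every
  other one some factor lies beyond it and vanishes. The prefactor \<open>k / (2 * i)\<close> is 1
  at \<open>k = 2 * i\<close>, and \<open>h = 0\<close> removes the linear term, so the Catalan
  recursion remains.\<close>

lemma moment_coeff_diagonal_Suc:
  "moment_coeff m 0 (2 * Suc n) (Suc n) =
    (\<Sum>j\<le>n. moment_coeff m 0 (2 * j) j * moment_coeff m 0 (2 * (n - j)) (n - j))"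
proof -
  define c where "c = moment_coeff m 0"
  have *: "c a j * c (2 * n - a) (n - j)
      = (if a = 2 * j then c (2 * j) j * c (2 * (n - j)) (n - j) else 0)"
    if "a \<le> 2 * n" "j \<le> n" for a j
  proof -
    have "a = 2 * j \<or> a < 2 * j \<or> 2 * n - a < 2 * (n - j)"
      using that by linarith
    then show ?thesis
      by (auto simp: c_def moment_coeff_eq_0 right_diff_distrib')
  qed
  have "c (2 * Suc n) (Suc n) = of_nat (2 * Suc n) / (2 * of_nat (Suc n)) *
      (\<Sum>a\<le>2 * n. \<Sum>j\<le>n. c a j * c (2 * n - a) (n - j))"
    by (simp add: c_def del: of_nat_Suc)
  also have "of_nat (2 * Suc n) / (2 * of_nat (Suc n)) = (1 :: complex)"
    by (simp only: of_nat_mult of_nat_numeral) (simp del: of_nat_Suc)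
  also have "(\<Sum>a\<le>2 * n. \<Sum>j\<le>n. c a j * c (2 * n - a) (n - j))
      = (\<Sum>j\<le>n. \<Sum>a\<le>2 * n. c a j * c (2 * n - a) (n - j))"
    by (rule sum.swap)
  also have "\<dots> = (\<Sum>j\<le>n. c (2 * j) j * c (2 * (n - j)) (n - j))"
    by (intro sum.cong refl) (simp add: * sum.delta)
  finally show ?thesis
    by (simp add: c_def)
qed

text \<open>Comparing coefficients of \<open>fps_X ^ k * t ^ l\<close> in the Burgers equation gives
  the coefficient of \<open>t ^ Suc l\<close> in the \<open>k\<close>-th power sum from those of
  degree at most \<open>l\<close> in \<open>t\<close>. The factor \<open>N\<close> appears because
  \<open>V\<close> carries sums over the zeros and \<open>moment_coeff\<close> their means.\<close>

lemma coeff_log_deriv_eq_moment_coeff: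
  fixes V :: "complex poly fps"
  assumes heat: "2 * of_nat N * coeff_deriv V
      = euler_deriv (fps_X ^ 2 * (V * V - V - euler_deriv V))"
    and "N > 0"
    and init: "\<And>k. coeff (fps_nth V k) 0 = of_nat N * m k"
  shows "coeff (fps_nth V k) i = of_nat N * moment_coeff m (1 / of_nat N) k i"
proof (induction i arbitrary: k rule: less_induct)
  case (less i)
  define c where "c = moment_coeff m (1 / of_nat N)"
  show ?case
  proof (cases i)
    case (Suc l)
    have IH: "coeff (fps_nth V a) j = of_nat N * c a j" if "j \<le> l" for a j
      using less.IH[of j a] that Suc by (simp add: c_def)
    have nat_mult: "fps_nth (of_nat j * F) k = of_nat j * fps_nth F k"
        for F :: "complex poly fps" and j k
      by (simp add: fps_of_nat[symmetric] del: fps_of_nat)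
    have coeff_nat: "coeff (of_nat j * p) l = of_nat j * coeff p l" for p :: "complex poly" and j l
      by (simp add: of_nat_poly)
    have "coeff (fps_nth (of_nat (2 * N) * coeff_deriv V) k) l =
        of_nat (2 * N) * (of_nat i * coeff (fps_nth V k) i)"
      by (simp only: nat_mult coeff_nat fps_nth_coeff_deriv coeff_pderiv Suc)
    moreover have "of_nat (2 * N) * coeff_deriv V = 2 * of_nat N * coeff_deriv V"
      by simp
    ultimately have 1: "of_nat (2 * N) * (of_nat i * coeff (fps_nth V k) i) =
        of_nat k * coeff (fps_nth (fps_X ^ 2 * (V * V - V - euler_deriv V)) k) l"
      by (simp only: heat fps_nth_euler_deriv coeff_nat)
    show ?thesis
    proof (cases "k < 2")
      case True
      then show ?thesis
        using 1 \<open>N > 0\<close> Suc by (simp add: fps_X_power_mult_nth del: of_nat_Suc)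
    next
      case False
      have "coeff (fps_nth (V * V) (k - 2)) l =
          of_nat N * of_nat N * (\<Sum>a\<le>k - 2. \<Sum>j\<le>l. c a j * c (k - 2 - a) (l - j))"
        by (simp add: fps_mult_nth coeff_sum coeff_mult atLeast0AtMost IH sum_distrib_left mult_ac)
      moreover have "of_nat (k - 1) = 1 + (of_nat (k - 2) :: complex)"
        using False by (simp add: of_nat_diff)
      ultimately have 2: "coeff (fps_nth (fps_X ^ 2 * (V * V - V - euler_deriv V)) k) l =
          of_nat N * of_nat N * ((\<Sum>a\<le>k - 2. \<Sum>j\<le>l. c a j * c (k - 2 - a) (l - j))
            - of_nat (k - 1) * (1 / of_nat N) * c (k - 2) l)"
        using \<open>N > 0\<close> False
        by (simp only: fps_X_power_mult_nth if_False fps_sub_nth coeff_diff fps_nth_euler_deriv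
          coeff_nat IH[OF order.refl]) (simp add: field_simps)
      have "of_nat (2 * N) * (of_nat i * coeff (fps_nth V k) i) =
         of_nat (2 * N) * (of_nat i * (of_nat N * c k i))"
        unfolding 1 2 using False \<open>N > 0\<close>
        by (simp add: Suc c_def del: of_nat_Suc)
      then show ?thesis
        using \<open>N > 0\<close> by (simp add: Suc c_def del: of_nat_Suc moment_coeff.simps)
    qed
  qed (simp add: init)
qed

section \<open>Power sums from a factorisation\<close>

text \<open>As for a logarithmic derivative, the first factor and the degree add up when the
  reversed polynomials are multiplied. It remains to check one linear factor, which gives the
  geometric series.\<close>

lemma power_sum_fps_prod:
  fixes z :: "'i \<Rightarrow> complex"
  assumes "finite S"
  shows "(\<Sum>i\<in>S. of_nat (e i) * Abs_fps (\<lambda>k. z i ^ k)) *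
      fps_of_poly (reflect_poly (\<Prod>i\<in>S. [:- z i, 1:] ^ e i)) =
    of_nat (\<Sum>i\<in>S. e i) * fps_of_poly (reflect_poly (\<Prod>i\<in>S. [:- z i, 1:] ^ e i))
      - euler_deriv (fps_of_poly (reflect_poly (\<Prod>i\<in>S. [:- z i, 1:] ^ e i)))"
proof -
  have mult: "(W1 + W2) * (R1 * R2) = of_nat (N1 + N2) * (R1 * R2) - euler_deriv (R1 * R2)"
    if "W1 * R1 = of_nat N1 * R1 - euler_deriv R1" "W2 * R2 = of_nat N2 * R2 - euler_deriv R2"
    for W1 W2 R1 R2 :: "complex fps" and N1 N2
  proof -
    have "(W1 + W2) * (R1 * R2) = (W1 * R1) * R2 + R1 * (W2 * R2)"
      by (simp add: algebra_simps)
    also have "\<dots> = of_nat (N1 + N2) * (R1 * R2) - euler_deriv (R1 * R2)"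
      unfolding that by (simp add: euler_deriv_mult algebra_simps)
    finally show ?thesis .
  qed
  have linear: "Abs_fps (\<lambda>k. x ^ k) * fps_of_poly (reflect_poly [:- x, 1:]) =
      of_nat 1 * fps_of_poly (reflect_poly [:- x, 1:])
          - euler_deriv (fps_of_poly (reflect_poly [:- x, 1:]))"
    for x :: complex
  proof -
    have R: "fps_of_poly (reflect_poly [:- x, 1:]) = 1 - fps_const x * fps_X"
      by (rule fps_ext) (auto simp: coeff_reflect_poly fps_X_def coeff_pCons split: nat.split)
    show ?thesis
      unfolding R
      by (rule fps_ext) (auto simp: right_diff_distrib mult.assoc[symmetric]
          mult.commute[of "Abs_fps _"]
        fps_X_mult_right_nth power_eq_if)
  qed
  have pow: "(of_nat l * Abs_fps (\<lambda>k. x ^ k)) * fps_of_poly (reflect_poly ([:- x, 1:] ^ l)) =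
      of_nat l * fps_of_poly (reflect_poly ([:- x, 1:] ^ l))
        - euler_deriv (fps_of_poly (reflect_poly ([:- x, 1:] ^ l)))"
    for x :: complex and l
  proof (induction l)
    case (Suc l)
    then show ?case
      using mult[OF linear[of x] Suc]
      by (simp add: reflect_poly_mult fps_of_poly_mult distrib_right del: mult_pCons_left)
  qed simp
  show ?thesis
    using assms
  proof induction
    case (insert i S)
    then show ?case
      using mult[OF pow[of "e i" "z i"] insert.IH]
      by (simp add: reflect_poly_mult fps_of_poly_mult)
  qed simp
qed

lemma power_sum_fps_unique:
  fixes V W R :: "'a::idom fps"
  assumes "V * R = of_nat N * R - euler_deriv R" "W * R = of_nat N * R - euler_deriv R" "R \<noteq> 0"
  shows "V = W"
  using assms by (metis mult_right_cancel)

section \<open>The heat equation for the coefficients and its solution at a fixed time\<close>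

definition eval_coeffs :: "'a::comm_ring_1 \<Rightarrow> 'a poly fps \<Rightarrow> 'a fps" where
  "eval_coeffs x F = Abs_fps (\<lambda>n. poly (fps_nth F n) x)"

lemma fps_nth_eval_coeffs [simp]: "fps_nth (eval_coeffs x F) n = poly (fps_nth F n) x"
  by (simp add: eval_coeffs_def)

lemma eval_coeffs_mult: "eval_coeffs x (F * G) = eval_coeffs x F * eval_coeffs x G"
  by (rule fps_ext) (simp add: fps_mult_nth poly_sum)

lemma eval_coeffs_log_deriv:
  assumes "V * R = of_nat N * R - euler_deriv R"
  shows "eval_coeffs x V * eval_coeffs x R
      = of_nat N * eval_coeffs x R - euler_deriv (eval_coeffs x R)"
proof -
  have "eval_coeffs x (V * R) = eval_coeffs x (of_nat N * R - euler_deriv R)"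
    by (simp add: assms)
  also have "\<dots> = of_nat N * eval_coeffs x R - euler_deriv (eval_coeffs x R)"
    by (rule fps_ext) (simp add: fps_of_nat[symmetric] del: fps_of_nat)
  finally show ?thesis
    by (simp add: eval_coeffs_mult)
qed

text \<open>
  The coefficient of \<open>z ^ (N - j)\<close> in \<open>exp (- t / (2 N) \<partial>\<^sup>2) Q\<close>, as a polynomial in \<open>t\<close>.
\<close>

definition heat_coeff :: "nat \<Rightarrow> complex poly \<Rightarrow> nat \<Rightarrow> complex poly" where
  "heat_coeff N Q j = (if j \<le> N then
     (\<Sum>k\<le>N. monom ((- 1 / (2 * of_nat N)) ^ k / fact k * coeff ((pderiv ^^ (2 * k)) Q) (N - j)) k)
         else 0)"

lemma degree_exp_deriv2 [simp]:
  shows "degree (exp_deriv2 c p) = degree p"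
    and coeff_degree_exp_deriv2 [simp]: "coeff (exp_deriv2 c p) (degree p) = lead_coeff p"
proof -
  have "coeff (exp_deriv2 c p) j = (\<Sum>k\<le>degree p. if k = 0 then coeff p j else 0)"
      if "j \<ge> degree p" for j
    unfolding exp_deriv2_def coeff_sum
  proof (intro sum.cong refl)
    fix k
    have "coeff ((pderiv ^^ (2 * k)) p) j = 0" if "k > 0"
      using that \<open>j \<ge> degree p\<close> by (simp add: coeff_higher_pderiv coeff_eq_0)
    then show "coeff (smult (c ^ k / fact k) ((pderiv ^^ (2 * k)) p)) j
        = (if k = 0 then coeff p j else 0)"
      by auto
  qed
  then have *: "coeff (exp_deriv2 c p) j = coeff p j" if "j \<ge> degree p" for j
    using that by simp
  have "degree (exp_deriv2 c p) \<le> degree p"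
    by (rule degree_le) (auto simp: * coeff_eq_0)
  moreover have "degree p \<le> degree (exp_deriv2 c p)"
    by (cases "p = 0") (auto intro!: le_degree simp: *)
  ultimately show "degree (exp_deriv2 c p) = degree p"
    by simp
  show "coeff (exp_deriv2 c p) (degree p) = lead_coeff p"
    by (simp add: *)
qed

lemma exp_deriv2_nonzero: "p \<noteq> 0 \<Longrightarrow> exp_deriv2 c p \<noteq> 0"
  using coeff_degree_exp_deriv2[of c p] by (metis coeff_0 leading_coeff_0_iff)

lemma poly_heat_coeff:
  assumes "degree Q = N"
  shows "poly (heat_coeff N Q j) x =
    coeff (reflect_poly (exp_deriv2 (- (x / (2 * of_nat N))) Q)) j"
proof -
  define c where "c = - (x / (2 * of_nat N))"
  have "c ^ k = (- 1 / (2 * of_nat N)) ^ k * x ^ k" for k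
    unfolding power_mult_distrib[symmetric] c_def by simp
  moreover have "coeff (reflect_poly (exp_deriv2 c Q)) j =
      (if j \<le> N then \<Sum>k\<le>N. c ^ k / fact k * coeff ((pderiv ^^ (2 * k)) Q) (N - j) else 0)"
    using assms by (auto simp: coeff_reflect_poly) (simp add: exp_deriv2_def coeff_sum)
  ultimately show ?thesis
    by (auto simp: heat_coeff_def poly_sum poly_monom c_def[symmetric] intro!: sum.cong)
qed

text \<open>Differentiating \<open>z ^ (N - (j - 2))\<close> twice lands on
  \<open>z ^ (N - j)\<close> and produces the two factors. The coefficients of \<open>z ^ N\<close>
  and \<open>z ^ (N - 1)\<close> have no source and stay constant.\<close>

lemma heat_coeff_heat:
  assumes "degree Q = N" "N > 0"
  shows "smult (2 * of_nat N) (pderiv (heat_coeff N Q j)) =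
    (if j < 2 then 0 else - smult ((of_nat N - of_nat (j - 2)) * (of_nat N - 1 - of_nat (j - 2)))
       (heat_coeff N Q (j - 2)))"
proof (rule poly_eqI)
  fix i
  have hc: "coeff (heat_coeff N Q j) i = (if j \<le> N then
     (- 1 / (2 * of_nat N)) ^ i / fact i * coeff ((pderiv ^^ (2 * i)) Q) (N - j) else 0)" for i j
  proof -
    have "coeff ((pderiv ^^ (2 * i)) Q) (N - j) = 0" if "i > N"
      using that assms by (simp add: coeff_higher_pderiv coeff_eq_0)
    then show ?thesis
      by (auto simp: heat_coeff_def coeff_sum if_distrib sum.delta)
  qed
  show "coeff (smult (2 * of_nat N) (pderiv (heat_coeff N Q j))) i =
    coeff (if j < 2 then 0 else - smult ((of_nat N - of_nat (j - 2))
        * (of_nat N - 1 - of_nat (j - 2)))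
       (heat_coeff N Q (j - 2))) i"
  proof (cases "j \<le> N")
    case True
    have d: "coeff ((pderiv ^^ (2 * Suc i)) Q) (N - j) =
       of_nat (Suc (N - j)) * of_nat (Suc (Suc (N - j)))
           * coeff ((pderiv ^^ (2 * i)) Q) (Suc (Suc (N - j)))"
      by (simp add: coeff_pderiv algebra_simps)
    have l: "coeff (smult (2 * of_nat N) (pderiv (heat_coeff N Q j))) i =
        - ((- 1 / (2 * of_nat N)) ^ i / fact i * coeff ((pderiv ^^ (2 * Suc i)) Q) (N - j))"
      using True assms by (simp add: coeff_pderiv hc field_simps del: of_nat_Suc funpow.simps)
    show ?thesis
    proof (cases "j < 2")
      case True
      then have "coeff ((pderiv ^^ (2 * i)) Q) (Suc (Suc (N - j))) = 0"
        using assms \<open>j \<le> N\<close> by (simp add: coeff_higher_pderiv coeff_eq_0)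
      then show ?thesis
        unfolding l d using True by simp
    next
      case False
      then have "of_nat N - of_nat (j - 2) = (of_nat (Suc (Suc (N - j))) :: complex)"
        "of_nat N - 1 - of_nat (j - 2) = (of_nat (Suc (N - j)) :: complex)"
        and *: "N - (j - 2) = Suc (Suc (N - j))" "j - 2 \<le> N"
        using \<open>j \<le> N\<close> by (auto simp: of_nat_diff)
      then show ?thesis
        unfolding l d using False
        by (simp only: if_False coeff_minus coeff_smult hc * if_True) (simp add: field_simps)
    qed
  next
    case False
    \<comment> \<open>The left side is 0 here. On the right the factors are complex differences, not
      truncated ones: one of them is 0 for \<open>j = N + 1\<close> and for
      \<open>j = N + 2\<close>, and beyond that \<open>heat_coeff\<close> itself is 0.\<close>
    then have "j = Suc N \<or> j = Suc (Suc N) \<or> j > N + 2"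
      by linarith
    then show ?thesis
      using False \<open>N > 0\<close> by (auto simp: coeff_pderiv hc)
  qed
qed

lemma power_sum_heat:
  fixes l :: "'i \<Rightarrow> complex" and t :: complex
  assumes "finite J" and N: "N = (\<Sum>j\<in>J. e j)" and "N > 0"
  defines "p \<equiv> exp_deriv2 (- (t / (2 * of_nat N))) (\<Prod>j\<in>J. [:- l j, 1:] ^ e j)"
  shows "(\<Sum>z | poly p z = 0. of_nat (order z p) * z ^ k) =
    of_nat N * (\<Sum>i\<le>k. moment_coeff (\<lambda>k. (\<Sum>j\<in>J. of_nat (e j) * l j ^ k) / of_nat N) (1 / of_nat N)
        k i * t ^ i)"
proof -
  define Q where "Q = (\<Prod>j\<in>J. [:- l j, 1:] ^ e j)"
  have degQ: "degree Q = N"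
    unfolding Q_def N by (subst degree_prod_sum_eq) (auto simp: degree_power_eq)
  have monQ: "lead_coeff Q = 1"
    unfolding Q_def by (simp add: lead_coeff_prod lead_coeff_power)
  have coeff_N: "coeff (exp_deriv2 c Q) N = 1" for c
    using coeff_degree_exp_deriv2[of c Q] degQ monQ by simp
  define R where "R = Abs_fps (heat_coeff N Q)"
  have R: "eval_coeffs x R = fps_of_poly (reflect_poly (exp_deriv2 (- (x / (2 * of_nat N))) Q))"
      for x
    by (rule fps_ext) (simp add: R_def poly_heat_coeff degQ)
  have R0: "eval_coeffs x R \<noteq> 0" for x
  proof -
    have "fps_nth (eval_coeffs x R) 0 = 1"
      unfolding R by (simp add: coeff_N degQ)
    then show ?thesis
      by (metis fps_zero_nth zero_neq_one)
  qed
  then have "R \<noteq> 0"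
    by (metis eval_coeffs_def fps_ext fps_nth_Abs_fps fps_zero_nth poly_0)
  have Rnth0: "fps_nth R 0 = 1"
  proof -
    have "poly (fps_nth R 0) x = poly 1 x" for x
      using R[of x] fps_nth_eval_coeffs[of x R 0]
      by (simp add: coeff_N degQ)
    then show ?thesis
      by (simp add: poly_eq_poly_eq_iff[symmetric] fun_eq_iff)
  qed
  \<comment> \<open>The constant term of \<open>R\<close> is the leading coefficient, which the flow
    keeps equal to 1. Hence \<open>R\<close> is a unit already over the polynomial ring, and the
    coefficients of \<open>V\<close> are polynomials in \<open>t\<close>.\<close>
  define V where "V = (of_nat N * R - euler_deriv R) * fps_right_inverse R 1"
  have "R * fps_right_inverse R 1 = 1"
    by (rule fps_right_inverse) (simp add: Rnth0)
  then have V: "V * R = of_nat N * R - euler_deriv R"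
    by (simp add: V_def mult.assoc mult.commute[of _ R])
  have "2 * of_nat N * coeff_deriv R = - (fps_X ^ 2 *
      (let S = of_nat N * R - euler_deriv R in of_nat N * S - S - euler_deriv S))"
  proof (rule fps_ext)
    fix j
    have nat_mult: "fps_nth (of_nat j * F) k = of_nat j * fps_nth F k"
        for F :: "complex poly fps" and j k
      by (simp add: fps_of_nat[symmetric] del: fps_of_nat)
    have sm: "of_nat j * p = smult (of_nat j) p" for p :: "complex poly" and j
      by (simp add: of_nat_poly)
    have quad: "smult a (smult a h - smult b h) - (smult a h - smult b h)
        - smult b (smult a h - smult b h) =
        smult ((a - b) * (a - 1 - b)) h" for a b :: complex and h
      by (rule poly_eqI) (simp add: algebra_simps)
    have "2 * of_nat N * coeff_deriv R = of_nat (2 * N) * coeff_deriv R"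
      by simp
    then have "fps_nth (2 * of_nat N * coeff_deriv R) j
        = smult (2 * of_nat N) (pderiv (heat_coeff N Q j))"
      by (simp only: nat_mult fps_nth_coeff_deriv sm) (simp add: R_def)
    moreover have "fps_nth (fps_X ^ 2 *
      (let S = of_nat N * R - euler_deriv R in of_nat N * S - S - euler_deriv S)) j =
      (if j < 2 then 0 else smult ((of_nat N - of_nat (j - 2)) * (of_nat N - 1 - of_nat (j - 2)))
       (heat_coeff N Q (j - 2)))"
      by (simp only: fps_X_power_mult_nth Let_def fps_sub_nth nat_mult fps_nth_euler_deriv sm quad)
        (simp add: R_def)
    ultimately show "fps_nth (2 * of_nat N * coeff_deriv R) j = fps_nth (- (fps_X ^ 2 *
      (let S = of_nat N * R - euler_deriv R in of_nat N * S - S - euler_deriv S))) j"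
      using heat_coeff_heat[OF degQ \<open>N > 0\<close>, of j]
      by (cases "j < 2") (simp_all only: fps_neg_nth if_True if_False minus_zero)
  qed
  from heat_flow_log_deriv[OF V this \<open>R \<noteq> 0\<close>]
  have heat: "2 * of_nat N * coeff_deriv V
      = euler_deriv (fps_X ^ 2 * (V * V - V - euler_deriv V))" .
  have nth_sum: "fps_nth (\<Sum>i\<in>S. of_nat (e i) * Abs_fps (\<lambda>k. z i ^ k)) k
      = (\<Sum>i\<in>S. of_nat (e i) * z i ^ k)"
    for S :: "'b set" and e and z :: "'b \<Rightarrow> complex" and k
    by (simp add: fps_sum_nth fps_of_nat[symmetric] del: fps_of_nat)
  define m where "m k = (\<Sum>j\<in>J. of_nat (e j) * l j ^ k) / of_nat N" for k
  have init: "coeff (fps_nth V k) 0 = of_nat N * m k" for k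
  proof -
    have "exp_deriv2 0 Q = Q"
    proof -
      have "exp_deriv2 0 Q = (\<Sum>k\<le>degree Q. if k = 0 then Q else 0)"
        unfolding exp_deriv2_def by (intro sum.cong refl) auto
      then show ?thesis
        by simp
    qed
    then have "eval_coeffs 0 R = fps_of_poly (reflect_poly Q)"
      by (simp add: R)
    then have "(\<Sum>j\<in>J. of_nat (e j) * Abs_fps (\<lambda>k. l j ^ k)) * eval_coeffs 0 R =
        of_nat N * eval_coeffs 0 R - euler_deriv (eval_coeffs 0 R)"
      using power_sum_fps_prod[OF \<open>finite J\<close>, of e l] by (simp only: Q_def N)
    then have "eval_coeffs 0 V = (\<Sum>j\<in>J. of_nat (e j) * Abs_fps (\<lambda>k. l j ^ k))"
      by (rule power_sum_fps_unique[OF eval_coeffs_log_deriv[OF V] _ R0])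
    then have "fps_nth (eval_coeffs 0 V) k = (\<Sum>j\<in>J. of_nat (e j) * l j ^ k)"
      by (simp only: nth_sum)
    then show ?thesis
      using \<open>N > 0\<close> by (simp add: m_def poly_0_coeff_0)
  qed
  have cV: "coeff (fps_nth V k) i = of_nat N * moment_coeff m (1 / of_nat N) k i" for k i
    by (rule coeff_log_deriv_eq_moment_coeff[OF heat \<open>N > 0\<close> init])
  have p_def': "p = exp_deriv2 (- (t / (2 * of_nat N))) Q"
    by (simp add: p_def Q_def)
  have p: "degree p = N" "lead_coeff p = 1"
    unfolding p_def' by (simp_all add: coeff_N degQ)
  then have "p \<noteq> 0"
    by auto
  define Z where "Z = {z. poly p z = 0}"
  have "finite Z"
    unfolding Z_def using \<open>p \<noteq> 0\<close> by (rule poly_roots_finite)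
  have decomp: "(\<Prod>z\<in>Z. [:- z, 1:] ^ order z p) = p"
    using complex_poly_decompose[of p] p by (simp add: Z_def)
  have "(\<Sum>z\<in>Z. order z p) = N"
  proof -
    have "N = degree (\<Prod>z\<in>Z. [:- z, 1:] ^ order z p)"
      by (simp only: decomp p)
    also have "\<dots> = (\<Sum>z\<in>Z. order z p)"
      by (subst degree_prod_sum_eq) (auto simp: degree_power_eq)
    finally show ?thesis ..
  qed
  moreover have "eval_coeffs t R = fps_of_poly (reflect_poly p)"
    by (simp only: R p_def')
  ultimately have "(\<Sum>z\<in>Z. of_nat (order z p) * Abs_fps (\<lambda>k. z ^ k)) * eval_coeffs t R =
      of_nat N * eval_coeffs t R - euler_deriv (eval_coeffs t R)"
    using power_sum_fps_prod[OF \<open>finite Z\<close>, of "\<lambda>z. order z p" "\<lambda>z. z"] by (simp only: decomp)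
  then have "eval_coeffs t V = (\<Sum>z\<in>Z. of_nat (order z p) * Abs_fps (\<lambda>k. z ^ k))"
    by (rule power_sum_fps_unique[OF eval_coeffs_log_deriv[OF V] _ R0])
  then have "fps_nth (eval_coeffs t V) k = (\<Sum>z\<in>Z. of_nat (order z p) * z ^ k)"
    by (simp only: nth_sum)
  moreover have "poly (fps_nth V k) t = (\<Sum>i\<le>k. coeff (fps_nth V k) i * t ^ i)"
  proof -
    have "degree (fps_nth V k) \<le> k"
      by (rule degree_le) (auto simp: cV moment_coeff_eq_0)
    then show ?thesis
      unfolding poly_altdef by (intro sum.mono_neutral_left) (auto simp: coeff_eq_0)
  qed
  ultimately show ?thesis
    by (simp add: cV Z_def m_def[abs_def] sum_distrib_left mult.assoc)
qed

subsection \<open>Zeros in a horizontal strip\<close>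

text \<open>The logarithmic derivative is the sum of \<open>1 / (z - r i)\<close>, and inversion
  flips the sign of the imaginary part. The real \<open>\<sigma>\<close> will be 1 or -1, so that
  upper and lower half-planes share one proof.\<close>

lemma Im_log_deriv_prod_linear:
  fixes r :: "nat \<Rightarrow> complex" and \<sigma> :: real
  assumes "\<And>i. i < n \<Longrightarrow> \<sigma> * Im (r i) < \<sigma> * Im z" "n > 0"
  defines "p \<equiv> \<lambda>n. \<Prod>i<n. [:- r i, 1:]"
  shows "\<sigma> * Im (poly (pderiv (p n)) z / poly (p n) z) < 0"
  using assms(2,1)
proof (induction n rule: nat_induct_non_zero)
  case (Suc n)
  have "z \<noteq> r i" if "i \<le> n" for i
    using Suc.prems[of i] that by auto
  then have nz: "poly (p n) z \<noteq> 0" "z - r n \<noteq> 0"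
    by (auto simp: p_def poly_prod)
  have "poly (pderiv (p (Suc n))) z / poly (p (Suc n)) z
      = poly (pderiv (p n)) z / poly (p n) z + 1 / (z - r n)"
    using nz by (simp add: p_def pderiv_mult pderiv_pCons field_simps del: mult_pCons_right
        mult_pCons_left)
  moreover have "\<sigma> * Im (1 / (z - r n)) < 0"
  proof -
    have "0 < (Re (z - r n))\<^sup>2 + (Im (z - r n))\<^sup>2"
      using nz(2) unfolding complex_neq_0 .
    moreover have "\<sigma> * (Im (r n) - Im z) < 0"
      using Suc.prems[of n] by (simp add: algebra_simps)
    ultimately show ?thesis
      by (simp add: Im_divide divide_neg_pos)
  qed
  ultimately show ?case
    using Suc by (simp add: distrib_left)
next
  case 1
  then have "\<sigma> * (Im (r 0) - Im z) < 0" "z - r 0 \<noteq> 0"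
    by (auto simp: algebra_simps)
  moreover from this have "0 < (Re (z - r 0))\<^sup>2 + (Im (z - r 0))\<^sup>2"
    unfolding complex_neq_0 by blast
  ultimately show ?case
    by (simp add: p_def pderiv_pCons Im_divide divide_neg_pos)
qed

lemma degree_diff_pderiv [simp]:
  fixes p :: "complex poly"
  shows "degree (p - smult a (pderiv p)) = degree p"
proof (cases "degree p = 0")
  case False
  then have "degree (- smult a (pderiv p)) < degree p"
    using degree_smult_le[of a "pderiv p"] by (simp add: degree_pderiv)
  then show ?thesis
    using degree_add_eq_left[of "- smult a (pderiv p)" p] by simp
next
  case True
  then have "pderiv p = 0"
    by (simp add: pderiv_eq_0_iff)
  then show ?thesis
    by simp
qed

lemma lead_coeff_diff_pderiv [simp]:
  fixes p :: "complex poly"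
  shows "lead_coeff (p - smult a (pderiv p)) = lead_coeff p"
  by (simp add: coeff_pderiv coeff_eq_0)

text \<open>At a zero of \<open>p - a p'\<close> where \<open>p\<close> does not vanish,
  \<open>p' / p\<close> equals the real number \<open>1 / a\<close>; outside the half-plane
  containing the zeros of \<open>p\<close> its imaginary part has a strict sign.\<close>

lemma roots_diff_pderiv_half_plane:
  fixes p :: "complex poly" and \<sigma> a B :: real
  assumes "p \<noteq> 0" and roots: "\<And>z. poly p z = 0 \<Longrightarrow> \<sigma> * Im z \<le> B"
    and z: "poly (p - smult (of_real a) (pderiv p)) z = 0"
  shows "\<sigma> * Im z \<le> B"
proof (rule ccontr)
  assume *: "\<not> \<sigma> * Im z \<le> B"
  then have "poly p z \<noteq> 0"
    using roots by blast
  have eq: "poly p z = of_real a * poly (pderiv p) z"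
    using z by simp
  obtain r where r: "smult (lead_coeff p) (\<Prod>i<degree p. [:- r i, 1:]) = p"
    by (rule complex_poly_decompose')
  define q where "q = (\<Prod>i<degree p. [:- r i, 1:])"
  have "degree p > 0"
    using eq \<open>poly p z \<noteq> 0\<close> pderiv_eq_0_iff[of p] by (metis gr0I mult_zero_right poly_0)
  moreover have "\<sigma> * Im (r i) < \<sigma> * Im z" if "i < degree p" for i
  proof -
    have "poly p (r i) = 0"
      by (subst r[symmetric]) (use that in \<open>auto simp: poly_prod\<close>)
    from roots[OF this] * show ?thesis
      by linarith
  qed
  ultimately have "\<sigma> * Im (poly (pderiv q) z / poly q z) < 0"
    unfolding q_def by (intro Im_log_deriv_prod_linear) auto
  moreover have "poly (pderiv q) z / poly q z = poly (pderiv p) z / poly p z"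
    using \<open>p \<noteq> 0\<close> by (subst (1 2) r[symmetric]) (simp add: pderiv_smult q_def)
  moreover have "poly (pderiv p) z / poly p z = of_real (1 / a)"
    using eq \<open>poly p z \<noteq> 0\<close> by (auto simp: field_simps)
  ultimately show False
    by simp
qed

section \<open>The heat operator as a limit of products\<close>

definition diff_pderiv2 :: "complex \<Rightarrow> complex poly \<Rightarrow> complex poly" where
  "diff_pderiv2 e p = p + smult e (pderiv (pderiv p))"

lemma diff_pderiv2_factor:
  "diff_pderiv2 (- (a ^ 2)) p =
    (let q = p - smult a (pderiv p) in q - smult (- a) (pderiv q))"
  by (simp add: diff_pderiv2_def Let_def pderiv_diff pderiv_smult smult_diff_right power2_eq_square)

text \<open>Degree and leading coefficient are carried along because the lower bound at a point
  outside the half-plane must be the same for all iterates.\<close>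

lemma diff_pderiv2_iterate:
  fixes p :: "complex poly"
  assumes "c \<ge> 0" "p \<noteq> 0" and roots: "\<And>z. poly p z = 0 \<Longrightarrow> \<sigma> * Im z \<le> B"
  shows "degree ((diff_pderiv2 (- of_real c) ^^ m) p) = degree p
    \<and> lead_coeff ((diff_pderiv2 (- of_real c) ^^ m) p) = lead_coeff p
    \<and> (\<forall>z. poly ((diff_pderiv2 (- of_real c) ^^ m) p) z = 0 \<longrightarrow> \<sigma> * Im z \<le> B)"
proof (induction m)
  case (Suc m)
  define P where "P = (diff_pderiv2 (- of_real c) ^^ m) p"
  define q where "q = P - smult (of_real (sqrt c)) (pderiv P)"
  have "- complex_of_real c = - (of_real (sqrt c) ^ 2)"
    using \<open>c \<ge> 0\<close> by (simp flip: of_real_power)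
  then have *: "(diff_pderiv2 (- of_real c) ^^ Suc m) p = q - smult (of_real (- sqrt c)) (pderiv q)"
    using diff_pderiv2_factor[of "of_real (sqrt c)" P] by (simp add: P_def q_def Let_def)
  have P: "degree P = degree p" "lead_coeff P = lead_coeff p" "P \<noteq> 0"
    using Suc \<open>p \<noteq> 0\<close> unfolding P_def by (blast, blast, metis leading_coeff_0_iff)
  moreover from P have q: "degree q = degree p" "lead_coeff q = lead_coeff p"
    unfolding q_def by (metis degree_diff_pderiv, metis lead_coeff_diff_pderiv)
  moreover from this have "q \<noteq> 0"
    using \<open>p \<noteq> 0\<close> by (metis leading_coeff_0_iff)
  moreover have "\<sigma> * Im z \<le> B" if "poly q z = 0" for z
    using roots_diff_pderiv_half_plane[of P \<sigma> B "sqrt c" z] Suc that P by (auto simp: P_def q_def)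
  ultimately show ?case
    unfolding * using roots_diff_pderiv_half_plane[of q \<sigma> B "- sqrt c"]
    by (metis degree_diff_pderiv lead_coeff_diff_pderiv)
qed (use roots in auto)

lemma higher_pderiv_eq_0: "degree p < k \<Longrightarrow> (pderiv ^^ k) p = (0 :: complex poly)"
  by (rule poly_eqI) (simp add: coeff_higher_pderiv coeff_eq_0)

text \<open>The binomial theorem for \<open>1 + e \<partial>^2\<close>, cut off at the degree of
  \<open>p\<close> instead of at \<open>m\<close>: with a number of summands independent of
  \<open>m\<close>, the limit \<open>m \<rightarrow> \<infinity>\<close> can be taken term by
  term.\<close>

lemma diff_pderiv2_iterate_eq_sum:
  "(diff_pderiv2 e ^^ m) p =
    (\<Sum>k\<le>degree p. smult (of_nat (m choose k) * e ^ k) ((pderiv ^^ (2 * k)) p))"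
proof (induction m)
  case 0
  have "(\<Sum>k\<le>degree p. smult (of_nat (0 choose k) * e ^ k) ((pderiv ^^ (2 * k)) p)) =
      (\<Sum>k\<le>degree p. if k = 0 then p else 0)"
    by (intro sum.cong refl) (auto simp: binomial_eq_0)
  then show ?case
    by simp
next
  case (Suc m)
  define N where "N = degree p"
  define g where "g k = (pderiv ^^ (2 * k)) p" for k
  have gN: "g (Suc N) = 0"
    unfolding g_def N_def by (rule higher_pderiv_eq_0) simp
  have g: "pderiv (pderiv (g k)) = g (Suc k)" for k
    by (simp add: g_def)
  have pd: "pderiv (\<Sum>k\<in>A. f k) = (\<Sum>k\<in>A. pderiv (f k))" for A and f :: "nat \<Rightarrow> complex poly"
    using higher_pderiv_sum[of 1 f A] by simp
  have sm: "smult a (\<Sum>k\<in>A. f k) = (\<Sum>k\<in>A. smult a (f k))" for a A and f :: "nat \<Rightarrow> complex poly"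
    by (induction A rule: infinite_finite_induct) (simp_all add: smult_add_right)
  have "(diff_pderiv2 e ^^ Suc m) p = diff_pderiv2 e
      (\<Sum>k\<le>N. smult (of_nat (m choose k) * e ^ k) (g k))"
    using Suc by (simp add: g_def N_def)
  also have "\<dots> = (\<Sum>k\<le>N. smult (of_nat (m choose k) * e ^ k) (g k))
      + (\<Sum>k\<le>N. smult (of_nat (m choose k) * e ^ Suc k) (g (Suc k)))"
    by (simp add: diff_pderiv2_def pd pderiv_smult g sm mult_ac)
  also have "(\<Sum>k\<le>N. smult (of_nat (m choose k) * e ^ Suc k) (g (Suc k))) =
      (\<Sum>k<N. smult (of_nat (m choose k) * e ^ Suc k) (g (Suc k)))"
    by (simp add: lessThan_Suc_atMost[symmetric] gN del: power_Suc)
  also have "(\<Sum>k\<le>N. smult (of_nat (m choose k) * e ^ k) (g k)) + \<dots> =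
      (\<Sum>k\<le>N. smult (of_nat (Suc m choose k) * e ^ k) (g k))"
    unfolding sum.atMost_shift
    by (simp add: sum.distrib[symmetric] smult_add_left[symmetric] distrib_right add_ac del:
        power_Suc)
  finally show ?case
    by (simp add: g_def N_def)
qed

lemma tendsto_choose_div_power:
  "(\<lambda>m. of_nat (m choose k) / of_nat m ^ k :: complex) \<longlonglongrightarrow> 1 / fact k"
proof (induction k)
  case (Suc k)
  have "(\<lambda>m. of_nat (m choose k) / of_nat m ^ k
      * ((1 - of_nat k / of_nat m) / of_nat (Suc k)) :: complex)
      \<longlonglongrightarrow> 1 / fact k * ((1 - 0) / of_nat (Suc k))"
    by (intro tendsto_intros Suc tendsto_divide_0[OF tendsto_const] tendsto_of_nat)
        (simp del: of_nat_Suc)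
  moreover have "\<forall>\<^sub>F m in sequentially. of_nat (m choose k) / of_nat m ^ k *
      ((1 - of_nat k / of_nat m) / of_nat (Suc k))
          = (of_nat (m choose Suc k) / of_nat m ^ Suc k :: complex)"
    using eventually_gt_at_top[of 0]
  proof eventually_elim
    case (elim m)
    have "of_nat m * of_nat (m choose k) =
        of_nat k * of_nat (m choose k) + of_nat (Suc k) * (of_nat (m choose Suc k) :: complex)"
      using gbinomial_mult_1[of "of_nat m :: complex" k] by (simp add: binomial_gbinomial)
    then have "(of_nat m - of_nat k) * of_nat (m choose k)
        = of_nat (Suc k) * (of_nat (m choose Suc k) :: complex)"
      by (simp add: algebra_simps)
    then show ?case
      using elim by (simp add: field_simps del: of_nat_Suc)
  qed
  ultimately show ?case
    by (auto simp: mult.commute elim: Lim_transform_eventually)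
qed simp

text \<open>
  The operator \<open>exp (- c \<partial>\<^sup>2)\<close> is the limit of \<open>(1 - c / m \<partial>\<^sup>2) ^ m\<close>, whose factors \<open>1 - a \<partial>\<close> with
  real \<open>a\<close> do not create zeros in a half-plane bounded by a horizontal line. Since the degree does
  not change, the iterates are bounded away from zero at any point outside the closed half-plane.
\<close>

lemma roots_exp_deriv2_half_plane:
  fixes p :: "complex poly"
  assumes "c \<ge> 0" "p \<noteq> 0" "\<bar>\<sigma>\<bar> = 1" and roots: "\<And>z. poly p z = 0 \<Longrightarrow> \<sigma> * Im z \<le> B"
    and z: "poly (exp_deriv2 (- of_real c) p) z = 0"
  shows "\<sigma> * Im z \<le> B"
proof (rule ccontr)
  assume *: "\<not> \<sigma> * Im z \<le> B"
  define N where "N = degree p"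
  define q where "q m = (diff_pderiv2 (- of_real (c / real m)) ^^ m) p" for m
  have "(\<lambda>m. poly (q m) z) \<longlonglongrightarrow> poly (exp_deriv2 (- of_real c) p) z"
  proof -
    have "poly (q m) z = (\<Sum>k\<le>N. (of_nat (m choose k) / of_nat m ^ k)
        * ((- of_real c) ^ k * poly ((pderiv ^^ (2 * k)) p) z))" for m
    proof -
      have "(- of_real (c / real m)) ^ k = (- of_real c) ^ k / (of_nat m ^ k :: complex)" for k
        unfolding power_divide[symmetric] by simp
      then show ?thesis
        by (simp add: q_def diff_pderiv2_iterate_eq_sum poly_sum N_def mult.assoc)
    qed
    moreover have "(\<lambda>m. \<Sum>k\<le>N. (of_nat (m choose k) / of_nat m ^ k)
        * ((- of_real c) ^ k * poly ((pderiv ^^ (2 * k)) p) z))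
        \<longlonglongrightarrow> (\<Sum>k\<le>N. 1 / fact k * ((- of_real c) ^ k * poly ((pderiv ^^ (2 * k)) p) z))"
      by (intro tendsto_sum tendsto_mult tendsto_choose_div_power tendsto_const)
    ultimately show ?thesis
      by (simp add: exp_deriv2_def poly_sum N_def)
  qed
  then have lim: "(\<lambda>m. cmod (poly (q m) z)) \<longlonglongrightarrow> 0"
    using z tendsto_norm by fastforce
  \<comment> \<open>Each of the \<open>N\<close> zeros of \<open>q m\<close> has vertical distance
    at least \<open>\<sigma> * Im z - B\<close> from \<open>z\<close>. This explicit bound does the
    work of Hurwitz's theorem.\<close>
  have "cmod (lead_coeff p) * (\<sigma> * Im z - B) ^ N \<le> cmod (poly (q m) z)" for m
  proof -
    have qm: "degree (q m) = N" "lead_coeff (q m) = lead_coeff p"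
        "\<And>z. poly (q m) z = 0 \<Longrightarrow> \<sigma> * Im z \<le> B"
      using diff_pderiv2_iterate[of "c / real m" p \<sigma> B m] assms by (auto simp: q_def N_def)
    obtain r where r: "smult (lead_coeff (q m)) (\<Prod>i<degree (q m). [:- r i, 1:]) = q m"
      by (rule complex_poly_decompose')
    have "(\<sigma> * Im z - B) ^ N = (\<Prod>i<N. \<sigma> * Im z - B)"
      by simp
    also have "\<dots> \<le> (\<Prod>i<N. cmod (z - r i))"
    proof (rule prod_mono)
      fix i assume "i \<in> {..<N}"
      then have "poly (q m) (r i) = 0"
        by (subst r[symmetric]) (auto simp: poly_prod qm)
      then have "\<sigma> * Im z - B \<le> \<sigma> * Im (z - r i)"
        using qm(3) by (fastforce simp: algebra_simps)
      also have "\<dots> \<le> \<bar>\<sigma> * Im (z - r i)\<bar>"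
        by simp
      also have "\<dots> \<le> cmod (z - r i)"
        using assms(3) abs_Im_le_cmod[of "z - r i"] by (simp add: abs_mult)
      finally show "0 \<le> \<sigma> * Im z - B \<and> \<sigma> * Im z - B \<le> cmod (z - r i)"
        using * by simp
    qed
    finally have "cmod (lead_coeff p) * (\<sigma> * Im z - B) ^ N
        \<le> cmod (lead_coeff p) * (\<Prod>i<N. cmod (z - r i))"
      by (intro mult_left_mono) auto
    also have "\<dots> = cmod (poly (q m) z)"
      by (subst r[symmetric]) (simp add: qm(2)[unfolded qm(1)] qm(1) poly_prod norm_mult prod_norm)
    finally show ?thesis .
  qed
  then have "cmod (lead_coeff p) * (\<sigma> * Im z - B) ^ N \<le> 0"
    by (intro tendsto_lowerbound[OF lim]) auto
  moreover have "cmod (lead_coeff p) * (\<sigma> * Im z - B) ^ N > 0"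
    using * \<open>p \<noteq> 0\<close> by simp
  ultimately show False
    by simp
qed

corollary roots_exp_deriv2_strip:
  fixes p :: "complex poly"
  assumes "c \<ge> 0" "p \<noteq> 0" "\<And>z. poly p z = 0 \<Longrightarrow> \<bar>Im z\<bar> \<le> B"
    and "poly (exp_deriv2 (- of_real c) p) z = 0"
  shows "\<bar>Im z\<bar> \<le> B"
  using roots_exp_deriv2_half_plane[of c p 1 B z] roots_exp_deriv2_half_plane[of c p "-1" B z] assms
  by (simp add: abs_le_iff)

subsection \<open>Moments of the semicircle law\<close>

definition real_semicircle :: "real measure" where
  "real_semicircle = density lborel (\<lambda>x. ennreal
      (indicator {-2..2} x * (sqrt (4 - x\<^sup>2) / (2 * pi))))"

definition semicircle_integral :: "nat \<Rightarrow> real" where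
  "semicircle_integral k = integral {-2..2} (\<lambda>x. x ^ k * sqrt (4 - x\<^sup>2))"

lemma continuous_on_semicircle_integrand:
  "continuous_on {-2..2 :: real} (\<lambda>x. x ^ k * sqrt (4 - x\<^sup>2))"
  by (intro continuous_intros)

lemma has_integral_semicircle_integral:
  "((\<lambda>x. x ^ k * sqrt (4 - x\<^sup>2)) has_integral semicircle_integral k) {-2..2}"
  unfolding semicircle_integral_def
  by (intro integrable_integral integrable_continuous_interval continuous_on_semicircle_integrand)

lemma sqrt_4_minus_pos: "\<bar>x\<bar> < 2 \<Longrightarrow> 0 < 4 - (x::real)\<^sup>2"
  using abs_square_less_1[of "x / 2"] by (simp add: power_divide)

lemma semicircle_integral_0: "semicircle_integral 0 = 2 * pi"
proof -
  \<comment> \<open>An antiderivative of the square root. Its two summands are not differentiable at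
    the end points, hence the form of the fundamental theorem that asks for derivatives in the
    interior only.\<close>
  define F where "F x = x * sqrt (4 - x\<^sup>2) / 2 + 2 * arcsin (x / 2)" for x :: real
  have "((\<lambda>x. x ^ 0 * sqrt (4 - x\<^sup>2)) has_integral (F 2 - F (- 2))) {-2..2}"
  proof (rule fundamental_theorem_of_calculus_interior)
    show "continuous_on {-2..2} F"
      unfolding F_def by (intro continuous_intros) auto
    fix x :: real assume "x \<in> {-2<..<2}"
    then have x: "0 < 4 - x\<^sup>2" "- 1 < x / 2" "x / 2 < 1"
      using sqrt_4_minus_pos[of x] by auto
    have "1 - (x / 2)\<^sup>2 = (4 - x\<^sup>2) / 2\<^sup>2"
      by (simp add: power_divide field_simps)
    then have "sqrt (1 - (x / 2)\<^sup>2) = sqrt (4 - x\<^sup>2) / 2"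
      by (simp only: real_sqrt_divide real_sqrt_abs)
    then have "(F has_real_derivative
        (sqrt (4 - x\<^sup>2) + x * (- 2 * x * inverse (sqrt (4 - x\<^sup>2)) / 2)) / 2
          + 2 * (inverse (sqrt (4 - x\<^sup>2) / 2) * (1 / 2))) (at x)"
      unfolding F_def using x by (auto intro!: derivative_eq_intros simp: field_simps)
    moreover have "(sqrt (4 - x\<^sup>2) + x * (- 2 * x * inverse (sqrt (4 - x\<^sup>2)) / 2)) / 2
          + 2 * (inverse (sqrt (4 - x\<^sup>2) / 2) * (1 / 2)) = sqrt (4 - x\<^sup>2)"
    proof -
      define s where "s = sqrt (4 - x\<^sup>2)"
      have "s > 0" "s * s = 4 - x * x"
        using x by (simp_all add: s_def power2_eq_square)
      then show ?thesis
        unfolding s_def[symmetric] by (simp add: field_simps)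
    qed
    ultimately show "(F has_vector_derivative x ^ 0 * sqrt (4 - x\<^sup>2)) (at x)"
      by (simp add: has_real_derivative_iff_has_vector_derivative)
  qed simp
  then have "semicircle_integral 0 = F 2 - F (- 2)"
    using has_integral_unique has_integral_semicircle_integral by blast
  then show ?thesis
    by (simp add: F_def arcsin_minus)
qed

text \<open>The integrand is the derivative of \<open>x ^ k\<close> times the power 3/2 of
  \<open>4 - x^2\<close>, which vanishes at both end points. The case \<open>k = 0\<close> gives the
  first moment (the truncated exponent \<open>k - 1\<close> is then multiplied by 0), the case
  \<open>Suc k\<close> a recursion between moments two apart.\<close>

lemma has_integral_semicircle_by_parts:
  "((\<lambda>x. of_nat k * x ^ (k - 1) * (4 - x\<^sup>2) * sqrt (4 - x\<^sup>2) - 3 * x ^ Suc k * sqrt (4 - x\<^sup>2))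
    has_integral 0) {-2..2 :: real}"
proof -
  define F where "F x = x ^ k * ((4 - x\<^sup>2) * sqrt (4 - x\<^sup>2))" for x :: real
  have "((\<lambda>x. of_nat k * x ^ (k - 1) * (4 - x\<^sup>2) * sqrt (4 - x\<^sup>2) - 3 * x ^ Suc k * sqrt (4 - x\<^sup>2))
      has_integral (F 2 - F (- 2))) {-2..2}"
  proof (rule fundamental_theorem_of_calculus_interior)
    show "continuous_on {-2..2} F"
      unfolding F_def by (intro continuous_intros)
    fix x :: real assume "x \<in> {-2<..<2}"
    then have x: "0 < 4 - x\<^sup>2"
      using sqrt_4_minus_pos[of x] by auto
    define s where "s = sqrt (4 - x\<^sup>2)"
    have s: "s > 0" "4 - x\<^sup>2 = s * s"
      using x by (simp_all add: s_def)
    have "(F has_real_derivative of_nat k * x ^ (k - 1) * ((4 - x\<^sup>2) * s)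
        + x ^ k * (- 2 * x * s + (4 - x\<^sup>2) * (- 2 * x * inverse s / 2))) (at x)"
      unfolding F_def s_def using x
      by (auto intro!: derivative_eq_intros simp: field_simps)
    moreover have "of_nat k * x ^ (k - 1) * ((4 - x\<^sup>2) * s)
        + x ^ k * (- 2 * x * s + (4 - x\<^sup>2) * (- 2 * x * inverse s / 2)) =
        of_nat k * x ^ (k - 1) * (4 - x\<^sup>2) * s - 3 * x ^ Suc k * s"
    proof -
      have "(4 - x\<^sup>2) * (- 2 * x * inverse s / 2) = - x * s"
        unfolding s(2) using s(1) by (simp add: field_simps)
      then show ?thesis
        by (simp only:) (simp add: algebra_simps)
    qed
    ultimately show "(F has_vector_derivative
        of_nat k * x ^ (k - 1) * (4 - x\<^sup>2) * sqrt (4 - x\<^sup>2) - 3 * x ^ Suc k * sqrt (4 - x\<^sup>2))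
            (at x)"
      by (simp only: has_real_derivative_iff_has_vector_derivative s_def)
  qed simp
  then show ?thesis
    by (simp add: F_def)
qed

lemma semicircle_integral_1: "semicircle_integral 1 = 0"
proof -
  have "((\<lambda>x. - 3 * (x ^ 1 * sqrt (4 - x\<^sup>2))) has_integral - 3 * semicircle_integral 1) {-2..2}"
    by (intro has_integral_mult_right has_integral_semicircle_integral)
  then have "- 3 * semicircle_integral 1 = 0"
    using has_integral_semicircle_by_parts[of 0]
    by (intro has_integral_unique[where f = "\<lambda>x. - 3 * (x ^ 1 * sqrt (4 - x\<^sup>2))"])
        (simp_all add: mult.assoc)
  then show ?thesis
    by simp
qed

lemma semicircle_integral_Suc_Suc:
  "of_nat (k + 4) * semicircle_integral (k + 2) = 4 * of_nat (k + 1) * semicircle_integral k"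
proof -
  have "((\<lambda>x. 4 * of_nat (k + 1) * (x ^ k * sqrt (4 - x\<^sup>2)) - of_nat (k + 4)
      * (x ^ (k + 2) * sqrt (4 - x\<^sup>2)))
    has_integral 4 * of_nat (k + 1) * semicircle_integral k - of_nat (k + 4)
        * semicircle_integral (k + 2)) {-2..2}"
    by (intro has_integral_diff has_integral_mult_right has_integral_semicircle_integral)
  moreover have "4 * of_nat (k + 1) * (x ^ k * sqrt (4 - x\<^sup>2)) - of_nat (k + 4)
      * (x ^ (k + 2) * sqrt (4 - x\<^sup>2)) =
    of_nat (Suc k) * x ^ (Suc k - 1) * (4 - x\<^sup>2) * sqrt (4 - x\<^sup>2) - 3 * x ^ Suc (Suc k)
        * sqrt (4 - x\<^sup>2)" for x :: real
    by (simp add: algebra_simps power2_eq_square)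
  ultimately have "4 * of_nat (k + 1) * semicircle_integral k - of_nat (k + 4)
      * semicircle_integral (k + 2) = 0"
    using has_integral_semicircle_by_parts[of "Suc k"] has_integral_unique
        by (metis (no_types, lifting) has_integral_cong)
  then show ?thesis
    by simp
qed

lemma semicircle_integral_odd: "odd k \<Longrightarrow> semicircle_integral k = 0"
proof (induction k rule: nat_induct2)
  case (step k)
  then show ?case
    using semicircle_integral_Suc_Suc[of k] by simp
qed (simp_all add: semicircle_integral_1[simplified])

lemma integral_real_semicircle:
  assumes "continuous_on UNIV g"
  shows "(\<integral>x. g x \<partial>real_semicircle) = integral {-2..2} (\<lambda>x. g x * sqrt (4 - x\<^sup>2)) / (2 * pi)"
proof -
  have [measurable]: "g \<in> borel_measurable borel"
    using assms by (rule borel_measurable_continuous_onI)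
  have nonneg: "0 \<le> indicator {-2..2} x * (sqrt (4 - x\<^sup>2) / (2 * pi))" for x :: real
    using abs_le_square_iff[of x 2] by (auto simp: indicator_def)
  have "(\<integral>x. g x \<partial>real_semicircle) = (\<integral>x. (indicator {-2..2} x * (sqrt (4 - x\<^sup>2) / (2 * pi)))
      * g x \<partial>lborel)"
    unfolding real_semicircle_def using nonneg by (subst integral_real_density) auto
  also have "\<dots> = (LINT x:{-2..2}|lborel. g x * sqrt (4 - x\<^sup>2) / (2 * pi))"
    unfolding set_lebesgue_integral_def by (intro Bochner_Integration.integral_cong)
        (auto simp: mult_ac)
  also have "\<dots> = integral {-2..2} (\<lambda>x. g x * sqrt (4 - x\<^sup>2) / (2 * pi))"
    by (intro set_borel_integral_eq_integral borel_integrable_atLeastAtMost')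
      (intro continuous_intros continuous_on_subset[OF assms], auto)
  also have "\<dots> = integral {-2..2} (\<lambda>x. g x * sqrt (4 - x\<^sup>2)) / (2 * pi)"
    by simp
  finally show ?thesis .
qed

lemma real_semicircle_moment:
  "(\<integral>x. x ^ k \<partial>real_semicircle) = semicircle_integral k / (2 * pi)"
  by (simp add: integral_real_semicircle continuous_intros semicircle_integral_def)

lemma sets_real_semicircle [measurable_cong, simp]: "sets real_semicircle = sets borel"
  by (simp add: real_semicircle_def)

lemma AE_real_semicircle: "AE x in real_semicircle. \<bar>x\<bar> \<le> 2"
  unfolding real_semicircle_def by (subst AE_density) (auto intro!: AE_I2 simp: indicator_def)

lemma prob_space_real_semicircle: "prob_space real_semicircle"
proof
  have "measure real_semicircle (space real_semicircle) = 1"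
    using real_semicircle_moment[of 0] by (simp add: semicircle_integral_0)
  \<comment> \<open>\<open>measure\<close> is 0 by convention where \<open>emeasure\<close> is
    infinite, so the value 1 excludes the infinite case.\<close>
  then show "emeasure real_semicircle (space real_semicircle) = 1"
    by (metis emeasure_eq_ennreal_measure ennreal_1 measure_zero_top zero_neq_one)
qed

section \<open>Catalan numbers as semicircle moments\<close>

text \<open>The heat flow yields a convolution, integration by parts a two-term recursion; this
  connects them. The generating function solves \<open>C = 1 + X C^2\<close>, so
  \<open>F = 1 - 2 X C\<close> is a square root of \<open>1 - 4 X\<close>, and differentiating
  \<open>F * F\<close> leads to the linear equation \<open>(1 - 4 X) F' = - 2 F\<close>.\<close>

lemma catalan_recurrence:
  fixes c :: "nat \<Rightarrow> 'a::field_char_0"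
  assumes "c 0 = 1" and conv: "\<And>n. c (Suc n) = (\<Sum>j\<le>n. c j * c (n - j))"
  shows "of_nat (n + 2) * c (Suc n) = 2 * of_nat (2 * n + 1) * c n"
proof -
  define C where "C = Abs_fps c"
  define F where "F = 1 - 2 * fps_X * C"
  have C: "C = 1 + fps_X * (C * C)"
  proof (rule fps_ext)
    have "fps_nth (C * C) n = c (Suc n)" for n
      by (simp add: C_def fps_mult_nth atLeast0AtMost conv)
    then show "fps_nth C n = fps_nth (1 + fps_X * (C * C)) n" for n
      using assms(1) by (cases n) (simp_all add: C_def)
  qed
  define D where "D = fps_X * (C * C)"
  have "F * F = 1 - 4 * fps_X * C + 4 * fps_X * D"
    by (simp add: F_def D_def algebra_simps)
  also have "\<dots> = 1 - 4 * fps_X * (1 + D) + 4 * fps_X * D"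
    using C by (simp only: D_def[symmetric])
  also have "\<dots> = 1 - 4 * fps_X"
    by (simp add: algebra_simps)
  finally have FF: "F * F = 1 - 4 * fps_X" .
  have "fps_deriv (F * F) = - 4"
    unfolding FF by simp
  then have "2 * (F * fps_deriv F) = 2 * (- 2)"
    by (simp add: mult.commute)
  then have FF': "F * fps_deriv F = - 2"
    by (subst (asm) mult_left_cancel) auto
  have "(1 - 4 * fps_X) * fps_deriv F = F * (F * fps_deriv F)"
    by (simp add: FF[symmetric] mult.assoc)
  then have eq: "fps_deriv F - fps_X * (4 * fps_deriv F) = - 2 * F"
    unfolding FF' by (simp add: algebra_simps)
  have F: "fps_nth F (Suc n) = - 2 * c n" for n
    by (simp add: F_def C_def mult.assoc numeral_fps_const)
  have "fps_nth (fps_deriv F - fps_X * (4 * fps_deriv F)) (Suc n) = fps_nth (- 2 * F) (Suc n)"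
    by (simp only: eq)
  then have "2 * (of_nat (n + 2) * c (Suc n)) = 2 * (2 * of_nat (2 * n + 1) * c n)"
    by (simp add: F numeral_fps_const algebra_simps)
  then show ?thesis
    by (subst (asm) mult_left_cancel) auto
qed

lemma real_semicircle_even_moment:
  fixes c :: "nat \<Rightarrow> complex"
  assumes "c 0 = 1" and "\<And>n. c (Suc n) = (\<Sum>j\<le>n. c j * c (n - j))"
  shows "c n = of_real (\<integral>x. x ^ (2 * n) \<partial>real_semicircle)"
proof (induction n)
  case 0
  then show ?case
    using assms by (simp only: real_semicircle_moment) (simp add: semicircle_integral_0)
next
  case (Suc n)
  define s where "s n = (\<integral>x. x ^ (2 * n) \<partial>real_semicircle)" for n
  have s: "s n = semicircle_integral (2 * n) / (2 * pi)" for n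
    by (simp only: s_def real_semicircle_moment)
  have "real (n + 2) * s (Suc n) = 2 * real (2 * n + 1) * s n"
    using semicircle_integral_Suc_Suc[of "2 * n"] unfolding s by (simp add: field_simps)
  then have "of_real (real (n + 2) * s (Suc n)) = (of_real (2 * real (2 * n + 1) * s n) :: complex)"
    by (simp only:)
  then have "of_nat (n + 2) * complex_of_real (s (Suc n)) = 2 * of_nat (2 * n + 1) * of_real (s n)"
    by simp
  also have "\<dots> = of_nat (n + 2) * c (Suc n)"
    using catalan_recurrence[of c n, OF assms] Suc by (simp add: s_def)
  finally have "of_nat (n + 2) * complex_of_real (s (Suc n)) = of_nat (n + 2) * c (Suc n)" .
  moreover have "of_nat (n + 2) \<noteq> (0 :: complex)"
    by (simp only: of_nat_eq_0_iff)
  ultimately have "complex_of_real (s (Suc n)) = c (Suc n)"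
    by (metis mult_left_cancel)
  then show ?case
    by (simp add: s_def)
qed

lemma real_semicircle_odd_moment:
  "odd k \<Longrightarrow> (\<integral>x. x ^ k \<partial>real_semicircle) = 0"
  by (simp add: real_semicircle_moment semicircle_integral_odd)

subsection \<open>Convergence of moments and weak convergence\<close>

lemma norm_power_diff_le:
  fixes z w :: "'a::real_normed_field"
  assumes "norm w \<le> norm z"
  shows "norm (z ^ m - w ^ m) \<le> norm (z - w) * (of_nat m * norm z ^ (m - 1))"
proof (cases m)
  case (Suc n)
  have "norm (\<Sum>p<Suc n. z ^ p * w ^ (n - p)) \<le> (\<Sum>p<Suc n. norm z ^ n)"
  proof (rule sum_norm_le)
    fix p assume "p \<in> {..<Suc n}"
    then have "norm z ^ n = norm z ^ p * norm z ^ (n - p)"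
      by (simp add: power_add[symmetric])
    then show "norm (z ^ p * w ^ (n - p)) \<le> norm z ^ n"
      using assms by (simp add: norm_mult norm_power mult_left_mono power_mono)
  qed
  then show ?thesis
    unfolding Suc diff_power_eq_sum norm_mult by (simp add: mult_left_mono del: sum.lessThan_Suc)
qed simp

text \<open>Both \<open>Re (z ^ m)\<close> and \<open>cmod z ^ m\<close> differ from
  \<open>Re z ^ m\<close>, for even \<open>m\<close>, by at most \<open>D\<close>, and the smallness
  of \<open>\<eta> * m\<close> gives \<open>D \<le> (1 + cmod z ^ m) / 4\<close>. Twice this is half
  of \<open>1 + cmod z ^ m\<close> and is absorbed on the left.\<close>

lemma norm_power_le_Re_power:
  assumes "\<bar>Im z\<bar> \<le> \<eta>" "even m" "4 * \<eta> * of_nat m \<le> 1"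
  shows "cmod z ^ m \<le> 2 * Re (z ^ m) + 1"
proof -
  define x where "x = Re z"
  define D where "D = \<eta> * (of_nat m * cmod z ^ (m - 1))"
  have "\<eta> \<ge> 0"
    using assms(1) by linarith
  have "cmod (z ^ m - of_real x ^ m) \<le> cmod (z - of_real x) * (of_nat m * cmod z ^ (m - 1))"
    by (rule norm_power_diff_le) (simp add: x_def abs_Re_le_cmod)
  also have "cmod (z - of_real x) = \<bar>Im z\<bar>"
    by (simp add: x_def cmod_def)
  also have "\<bar>Im z\<bar> * (of_nat m * cmod z ^ (m - 1)) \<le> D"
    unfolding D_def using assms(1) by (intro mult_right_mono) auto
  finally have 1: "\<bar>Re (z ^ m) - x ^ m\<bar> \<le> D"
    using abs_Re_le_cmod[of "z ^ m - of_real x ^ m"] by (simp flip: of_real_power)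
  have "norm (cmod z ^ m - \<bar>x\<bar> ^ m) \<le> norm (cmod z - \<bar>x\<bar>) * (of_nat m * norm (cmod z) ^ (m - 1))"
    by (rule norm_power_diff_le) (simp add: x_def abs_Re_le_cmod)
  also have "norm (cmod z - \<bar>x\<bar>) \<le> \<eta>"
    using cmod_le[of z] abs_Re_le_cmod[of z] assms(1) by (simp add: x_def)
  then have "norm (cmod z - \<bar>x\<bar>) * (of_nat m * norm (cmod z) ^ (m - 1)) \<le> D"
    unfolding D_def by (intro mult_mono) (use \<open>\<eta> \<ge> 0\<close> in auto)
  finally have 2: "cmod z ^ m \<le> x ^ m + D"
    using \<open>even m\<close> by (simp add: power_even_abs)
  have "cmod z ^ (m - 1) \<le> 1 + cmod z ^ m"
  proof (cases "cmod z \<le> 1")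
    case True
    then show ?thesis
      by (simp add: power_le_one add_increasing2)
  next
    case False
    then have "cmod z ^ (m - 1) \<le> cmod z ^ m"
      by (intro power_increasing) auto
    then show ?thesis
      by simp
  qed
  then have "D \<le> \<eta> * of_nat m * (1 + cmod z ^ m)"
    unfolding D_def mult.assoc using \<open>\<eta> \<ge> 0\<close> by (intro mult_left_mono) auto
  also have "\<dots> \<le> 1 / 4 * (1 + cmod z ^ m)"
    using assms(3) by (intro mult_right_mono) auto
  finally show ?thesis
    using 1 2 by (simp add: abs_le_iff)
qed

lemma (in prob_space) integral_diff_le:
  fixes f g :: "'a \<Rightarrow> real"
  assumes "integrable M f" "integrable M g" "AE x in M. \<bar>f x - g x\<bar> \<le> e"
  shows "\<bar>(\<integral>x. f x \<partial>M) - (\<integral>x. g x \<partial>M)\<bar> \<le> e"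
proof -
  have "\<bar>(\<integral>x. f x \<partial>M) - (\<integral>x. g x \<partial>M)\<bar> = \<bar>\<integral>x. f x - g x \<partial>M\<bar>"
    using assms by simp
  also have "\<dots> \<le> (\<integral>x. \<bar>f x - g x\<bar> \<partial>M)"
    by (rule integral_abs_bound)
  also have "\<dots> \<le> (\<integral>x. e \<partial>M)"
    using assms by (intro integral_mono_AE) auto
  finally show ?thesis
    by (simp add: prob_space)
qed

text \<open>
  Outside a neighbourhood of \<open>[-3, 3]\<close> the error of a polynomial approximation of \<open>f\<close> of degree
  at most \<open>m\<close> is \<open>O((|z| / 3) ^ m)\<close>, while the \<open>m\<close>-th absolute moment is \<open>O(2 ^ m)\<close>: since the
  atoms are close to the real axis, it is controlled by the real part of the \<open>m\<close>-th moment.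
\<close>

lemma method_of_moments_near_real_axis:
  fixes \<nu> :: "real measure" and f :: "complex \<Rightarrow> real"
  assumes "prob_space \<nu>" and sets [measurable_cong]: "sets \<nu> = sets borel"
    and AE2: "AE x in \<nu>. \<bar>x\<bar> \<le> 2"
    and f: "continuous_on UNIV f" "bounded (range f)" and "\<delta> > 0"
  obtains \<eta> K where "\<eta> > 0"
    "\<And>S w z. finite S \<Longrightarrow> (\<And>i. i \<in> S \<Longrightarrow> 0 \<le> w i) \<Longrightarrow> sum w S = 1 \<Longrightarrow>
      (\<And>i. i \<in> S \<Longrightarrow> \<bar>Im (z i)\<bar> \<le> \<eta>) \<Longrightarrow>
      (\<And>k. k \<le> K \<Longrightarrow> cmod ((\<Sum>i\<in>S. of_real (w i) * z i ^ k) - of_real (\<integral>x. x ^ k \<partial>\<nu>)) \<le> \<eta>) \<Longrightarrow>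
      \<bar>(\<Sum>i\<in>(S :: 'i set). w i * f (z i)) - (\<integral>x. f (of_real x) \<partial>\<nu>)\<bar> \<le> \<delta>"
proof -
  interpret prob_space \<nu> by fact
  \<comment> \<open>Three parts go to the error \<open>h\<close> on the atoms, one to the moments
    entering \<open>G\<close>, one to replacing \<open>f\<close> by \<open>g\<close> in the integral
    over \<open>\<nu>\<close>.\<close>
  define \<epsilon> where "\<epsilon> = \<delta> / 5"
  have "\<epsilon> > 0"
    using \<open>\<delta> > 0\<close> by (simp add: \<epsilon>_def)
  obtain M where M: "\<And>z. \<bar>f z\<bar> \<le> M"
    using f(2) by (auto simp: bounded_iff)
  then have "M \<ge> 0"
    by (meson abs_ge_zero order_trans)
  have f_real: "continuous_on UNIV (\<lambda>x. f (of_real x))"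
    by (rule continuous_on_compose2[OF f(1)]) (auto intro!: continuous_intros)
  obtain g where g: "real_polynomial_function g" "\<And>x. x \<in> {-3..3} \<Longrightarrow> \<bar>f (of_real x) - g x\<bar> < \<epsilon>"
    using Stone_Weierstrass_real_polynomial_function[of "{-3..3}" "\<lambda>x. f (of_real x)" \<epsilon>] \<open>\<epsilon> > 0\<close>
      continuous_on_subset[OF f_real] by auto
  then obtain a D where a: "g = (\<lambda>x. \<Sum>i\<le>D. a i * x ^ i)"
    by (auto simp: real_polynomial_function_iff_sum)
  define A where "A = (\<Sum>i\<le>D. \<bar>a i\<bar>)"
  have "A \<ge> 0"
    by (simp add: A_def sum_nonneg)
  \<comment> \<open>The real part of the polynomial \<open>g\<close> at a complex point: it agrees
    with \<open>g\<close> on the real axis, and its mean over the atoms is a combination of real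
    parts of their complex moments.\<close>
  define G where "G z = (\<Sum>i\<le>D. a i * Re (z ^ i))" for z :: complex
  have G_real: "G (of_real x) = g x" for x
    by (simp add: G_def a flip: of_real_power)
  define h where "h z = f z - G z" for z
  have h_cont: "continuous_on UNIV h"
    unfolding h_def G_def by (intro continuous_intros f(1))
  define box where "box = cbox (Complex (- 3) (- 1)) (Complex 3 1)"
  have in_box: "z \<in> box \<longleftrightarrow> \<bar>Re z\<bar> \<le> 3 \<and> \<bar>Im z\<bar> \<le> 1" for z
    by (auto simp: box_def in_cbox_complex_iff abs_le_iff)
  have "uniformly_continuous_on box h"
    unfolding box_def by (intro compact_uniformly_continuous continuous_on_subset[OF h_cont]) auto
  then obtain d where "d > 0" and
      d: "\<And>z z'. z \<in> box \<Longrightarrow> z' \<in> box \<Longrightarrow> dist z' z < d \<Longrightarrow> dist (h z') (h z) < \<epsilon>"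
    using \<open>\<epsilon> > 0\<close> unfolding uniformly_continuous_on_def by metis
  define C where "C = M + A"
  have "C \<ge> 0"
    using \<open>M \<ge> 0\<close> \<open>A \<ge> 0\<close> by (simp add: C_def)
  \<comment> \<open>The last left side will bound the contribution of the atoms with
    \<open>\<bar>Re z\<bar> > 3\<close>; as 3 exceeds the radius 2 of the support of
    \<open>\<nu>\<close>, the ratio 2/3 beats the fixed factor \<open>3 ^ D\<close>. Evenness is for
    \<open>norm_power_le_Re_power\<close>, and \<open>m\<close> also serves as
    \<open>K\<close>.\<close>
  obtain m where m: "even m" "D \<le> m" "5 * C * 3 ^ D * (2 / 3) ^ m \<le> \<epsilon>"
  proof -
    have "(\<lambda>n. 5 * C * 3 ^ D * (2 / 3 :: real) ^ n) \<longlonglongrightarrow> 5 * C * 3 ^ D * 0"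
      by (intro tendsto_intros LIMSEQ_power_zero) auto
    then have "\<forall>\<^sub>F n in sequentially. 5 * C * 3 ^ D * (2 / 3 :: real) ^ n < \<epsilon>"
      using \<open>\<epsilon> > 0\<close> by (intro order_tendstoD) auto
    then obtain n0 where n0: "\<And>n. n \<ge> n0 \<Longrightarrow> 5 * C * 3 ^ D * (2 / 3 :: real) ^ n < \<epsilon>"
      by (auto simp: eventually_sequentially)
    show ?thesis
      using n0[of "2 * (n0 + D)"] by (intro that[of "2 * (n0 + D)"]) auto
  qed
  \<comment> \<open>In order: atoms with \<open>\<bar>Re z\<bar> \<le> 3\<close> lie in
    \<open>box\<close>; uniform continuity applies there; the moment errors weighted by
    \<open>a\<close> stay below \<open>\<epsilon>\<close>; \<open>norm_power_le_Re_power\<close>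
    applies. The added 1 keeps the denominators positive.\<close>
  define \<eta> where "\<eta> = Min {1, d / 2, \<epsilon> / (A + 1), 1 / (4 * real m + 1)}"
  have "\<eta> > 0"
    using \<open>d > 0\<close> \<open>\<epsilon> > 0\<close> \<open>A \<ge> 0\<close> by (simp add: \<eta>_def)
  have \<eta>: "\<eta> \<le> 1" "\<eta> \<le> d / 2" "\<eta> \<le> \<epsilon> / (A + 1)" "\<eta> \<le> 1 / (4 * real m + 1)"
    unfolding \<eta>_def by (rule Min_le; simp)+
  have \<eta>m: "4 * \<eta> * real m \<le> 1"
  proof -
    have "4 * \<eta> * real m \<le> \<eta> * (4 * real m + 1)"
      using \<open>\<eta> > 0\<close> by (simp add: algebra_simps)
    also have "\<dots> \<le> 1"
      using \<eta>(4) by (simp add: pos_le_divide_eq)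
    finally show ?thesis .
  qed
  have \<eta>A: "A * \<eta> \<le> \<epsilon>"
  proof -
    have "A * \<eta> \<le> \<eta> * (A + 1)"
      using \<open>\<eta> > 0\<close> by (simp add: algebra_simps)
    also have "\<dots> \<le> \<epsilon>"
      using \<eta>(3) \<open>A \<ge> 0\<close> by (simp add: pos_le_divide_eq)
    finally show ?thesis .
  qed
  have h_bound: "\<bar>h z\<bar> \<le> 2 * \<epsilon> + C * (3 ^ D / 3 ^ m) * cmod z ^ m" if "\<bar>Im z\<bar> \<le> \<eta>" for z
  proof (cases "\<bar>Re z\<bar> \<le> 3")
    case True
    have "dist z (of_real (Re z)) = \<bar>Im z\<bar>"
      by (simp add: dist_norm cmod_def)
    then have "dist z (of_real (Re z)) < d"
      using that \<eta>(2) \<open>d > 0\<close> by simp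
    then have "\<bar>h z - h (of_real (Re z))\<bar> < \<epsilon>"
      using d[of "of_real (Re z)" z] True that \<eta>(1) by (auto simp: in_box dist_real_def)
    moreover have "\<bar>h (of_real (Re z))\<bar> < \<epsilon>"
      using g(2)[of "Re z"] True by (simp add: h_def G_real abs_le_iff)
    moreover have "0 \<le> C * (3 ^ D / 3 ^ m) * cmod z ^ m"
      using \<open>C \<ge> 0\<close> by simp
    ultimately show ?thesis
      by linarith
  next
    case False
    then have z3: "cmod z \<ge> 3"
      using abs_Re_le_cmod[of z] by linarith
    have "\<bar>G z\<bar> \<le> (\<Sum>i\<le>D. \<bar>a i * Re (z ^ i)\<bar>)"
      unfolding G_def by (rule sum_abs)
    also have "\<dots> \<le> (\<Sum>i\<le>D. \<bar>a i\<bar> * cmod z ^ D)"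
    proof (rule sum_mono)
      fix i assume "i \<in> {..D}"
      have "\<bar>Re (z ^ i)\<bar> \<le> cmod z ^ i"
        using abs_Re_le_cmod[of "z ^ i"] by (simp add: norm_power)
      also have "\<dots> \<le> cmod z ^ D"
        using z3 \<open>i \<in> {..D}\<close> by (intro power_increasing) auto
      finally show "\<bar>a i * Re (z ^ i)\<bar> \<le> \<bar>a i\<bar> * cmod z ^ D"
        by (simp add: abs_mult mult_left_mono)
    qed
    finally have "\<bar>G z\<bar> \<le> A * cmod z ^ D"
      by (simp add: A_def sum_distrib_right)
    moreover have "\<bar>f z\<bar> \<le> M * cmod z ^ D"
      using M[of z] \<open>M \<ge> 0\<close> z3 mult_left_mono[of 1 "cmod z ^ D" M] by (simp add: one_le_power)
    ultimately have "\<bar>h z\<bar> \<le> C * cmod z ^ D"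
      by (simp add: h_def C_def distrib_right)
    also have "cmod z ^ D \<le> 3 ^ D / 3 ^ m * cmod z ^ m"
    proof -
      have m_eq: "m = D + (m - D)"
        using m(2) by simp
      have "(3 :: real) ^ (m - D) \<le> cmod z ^ (m - D)"
        using z3 by (intro power_mono) auto
      then have "cmod z ^ D * 3 ^ (m - D) \<le> cmod z ^ D * cmod z ^ (m - D)"
        by (intro mult_left_mono) auto
      then have "cmod z ^ D * 3 ^ (m - D) \<le> cmod z ^ m"
        by (simp add: power_add[symmetric] m(2))
      then have "cmod z ^ D \<le> cmod z ^ m / 3 ^ (m - D)"
        by (simp add: pos_le_divide_eq)
      moreover have "(3 :: real) ^ m = 3 ^ D * 3 ^ (m - D)"
        by (simp add: power_add[symmetric] m(2))
      ultimately show ?thesis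
        by simp
    qed
    then have "C * cmod z ^ D \<le> C * (3 ^ D / 3 ^ m * cmod z ^ m)"
      using \<open>C \<ge> 0\<close> by (rule mult_left_mono)
    finally show ?thesis
      using \<open>\<epsilon> > 0\<close> by (simp add: mult.assoc)
  qed
  have int_pow: "integrable \<nu> (\<lambda>x. x ^ k)" for k
  proof (rule integrable_const_bound)
    show "AE x in \<nu>. norm (x ^ k) \<le> 2 ^ k"
      using AE2 by eventually_elim (simp add: power_abs power_mono)
  qed measurable
  have abs_moment: "\<bar>\<integral>x. x ^ k \<partial>\<nu>\<bar> \<le> 2 ^ k" for k
  proof -
    have "AE x in \<nu>. \<bar>x ^ k - 0\<bar> \<le> 2 ^ k"
      using AE2 by eventually_elim (simp add: power_abs power_mono)
    from integral_diff_le[OF int_pow integrable_zero this] show ?thesis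
      by simp
  qed
  show ?thesis
  proof (rule that[OF \<open>\<eta> > 0\<close>, of m])
    fix S :: "'i set" and w :: "'i \<Rightarrow> real" and z :: "'i \<Rightarrow> complex"
    assume S: "finite S" and w: "\<And>i. i \<in> S \<Longrightarrow> 0 \<le> w i" "sum w S = 1"
      and Im: "\<And>i. i \<in> S \<Longrightarrow> \<bar>Im (z i)\<bar> \<le> \<eta>"
      and mom: "\<And>k. k \<le> m \<Longrightarrow> cmod ((\<Sum>i\<in>S. of_real (w i) * z i ^ k) - of_real (\<integral>x. x ^ k \<partial>\<nu>)) \<le> \<eta>"
    have Re_mom: "\<bar>(\<Sum>i\<in>S. w i * Re (z i ^ k)) - (\<integral>x. x ^ k \<partial>\<nu>)\<bar> \<le> \<eta>" if "k \<le> m" for k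
      using mom[OF that] abs_Re_le_cmod[of "(\<Sum>i\<in>S. of_real (w i) * z i ^ k)
          - of_real (\<integral>x. x ^ k \<partial>\<nu>)"]
      by simp
    have "(\<Sum>i\<in>S. w i * cmod (z i) ^ m) \<le> (\<Sum>i\<in>S. w i * (2 * Re (z i ^ m) + 1))"
      using w(1) Im \<eta>m m(1) by (intro sum_mono mult_left_mono norm_power_le_Re_power) auto
    also have "\<dots> = 2 * (\<Sum>i\<in>S. w i * Re (z i ^ m)) + 1"
      using w(2) by (simp add: distrib_left sum.distrib sum_distrib_left mult_ac)
    \<comment> \<open>The real moment is at most \<open>2 ^ m + \<eta>\<close> with
      \<open>\<eta> \<le> 1\<close>, and \<open>2 * (2 ^ m + 1) + 1 \<le> 5 * 2 ^ m\<close>.\<close>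
    also have "\<dots> \<le> 5 * 2 ^ m"
    proof -
      have "1 \<le> (2 :: real) ^ m"
        by simp
      then show ?thesis
        using Re_mom[OF order.refl] abs_moment[of m] \<eta>(1) unfolding abs_le_iff by linarith
    qed
    finally have tail: "(\<Sum>i\<in>S. w i * cmod (z i) ^ m) \<le> 5 * 2 ^ m" .
    have "\<bar>\<Sum>i\<in>S. w i * h (z i)\<bar> \<le> (\<Sum>i\<in>S. w i * \<bar>h (z i)\<bar>)"
      using w(1) by (intro order.trans[OF sum_abs] sum_mono) (simp add: abs_mult)
    also have "\<dots> \<le> (\<Sum>i\<in>S. w i * (2 * \<epsilon> + C * (3 ^ D / 3 ^ m) * cmod (z i) ^ m))"
      using w(1) Im by (intro sum_mono mult_left_mono h_bound) auto
    also have "\<dots> = 2 * \<epsilon> * sum w S + C * (3 ^ D / 3 ^ m) * (\<Sum>i\<in>S. w i * cmod (z i) ^ m)"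
      by (simp add: distrib_left sum.distrib sum_distrib_left sum_distrib_right sum_divide_distrib
          mult_ac)
    also have "\<dots> \<le> 2 * \<epsilon> + C * (3 ^ D / 3 ^ m) * (5 * 2 ^ m)"
    proof -
      have "C * (3 ^ D / 3 ^ m) * (\<Sum>i\<in>S. w i * cmod (z i) ^ m) \<le> C * (3 ^ D / 3 ^ m) * (5 * 2 ^ m)"
        using \<open>C \<ge> 0\<close> tail by (intro mult_left_mono) auto
      then show ?thesis
        using w(2) by simp
    qed
    also have "C * (3 ^ D / 3 ^ m) * (5 * 2 ^ m) = 5 * C * 3 ^ D * (2 / 3) ^ m"
      by (simp add: power_divide)
    finally have 1: "\<bar>\<Sum>i\<in>S. w i * h (z i)\<bar> \<le> 3 * \<epsilon>"
      using m(3) by linarith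
    have "(\<Sum>i\<in>S. w i * G (z i)) = (\<Sum>i\<in>S. \<Sum>k\<le>D. a k * (w i * Re (z i ^ k)))"
      by (simp add: G_def sum_distrib_left mult_ac)
    also have "\<dots> = (\<Sum>k\<le>D. a k * (\<Sum>i\<in>S. w i * Re (z i ^ k)))"
      by (subst sum.swap) (simp add: sum_distrib_left)
    finally have "(\<Sum>i\<in>S. w i * G (z i)) - (\<integral>x. g x \<partial>\<nu>) =
        (\<Sum>k\<le>D. a k * ((\<Sum>i\<in>S. w i * Re (z i ^ k)) - (\<integral>x. x ^ k \<partial>\<nu>)))"
      by (simp add: a int_pow right_diff_distrib sum_subtractf)
    also have "\<bar>\<dots>\<bar> \<le> (\<Sum>k\<le>D. \<bar>a k\<bar> * \<eta>)"
      using Re_mom m(2)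
      by (intro order.trans[OF sum_abs] sum_mono) (auto simp: abs_mult intro!: mult_left_mono)
    also have "\<dots> \<le> \<epsilon>"
      using \<eta>A by (simp add: A_def sum_distrib_right)
    finally have 2: "\<bar>(\<Sum>i\<in>S. w i * G (z i)) - (\<integral>x. g x \<partial>\<nu>)\<bar> \<le> \<epsilon>" .
    have [measurable]: "(\<lambda>x. f (of_real x)) \<in> borel_measurable borel"
      using f_real by (rule borel_measurable_continuous_onI)
    have 3: "\<bar>(\<integral>x. g x \<partial>\<nu>) - (\<integral>x. f (of_real x) \<partial>\<nu>)\<bar> \<le> \<epsilon>"
    proof (rule integral_diff_le)
      show "integrable \<nu> g"
        unfolding a by (intro Bochner_Integration.integrable_sum integrable_mult_right int_pow)
      show "integrable \<nu> (\<lambda>x. f (of_real x))"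
        by (rule integrable_const_bound[where B = M]) (use M in auto)
      show "AE x in \<nu>. \<bar>g x - f (of_real x)\<bar> \<le> \<epsilon>"
        using AE2
      proof eventually_elim
        case (elim x)
        then have "x \<in> {-3..3}"
          by auto
        from g(2)[OF this] show ?case
          by linarith
      qed
    qed
    have "(\<Sum>i\<in>S. w i * f (z i)) = (\<Sum>i\<in>S. w i * h (z i)) + (\<Sum>i\<in>S. w i * G (z i))"
      by (simp add: h_def right_diff_distrib sum_subtractf)
    then show "\<bar>(\<Sum>i\<in>S. w i * f (z i)) - (\<integral>x. f (of_real x) \<partial>\<nu>)\<bar> \<le> \<delta>"
      using 1 2 3 unfolding \<epsilon>_def by linarith
  qed
qed

section \<open>Passage to the limits in \<open>n\<close> and \<open>t\<close>\<close>

lemma integral_zero_measure: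
  fixes g :: "complex \<Rightarrow> real"
  assumes "p \<noteq> 0" "continuous_on UNIV g"
  shows "(\<integral>x. g x \<partial>zero_measure N p) = (\<Sum>z | poly p z = 0. real (order z p) / real N * g z)"
proof -
  have "g \<in> borel_measurable borel"
    using assms(2) by (rule borel_measurable_continuous_onI)
  then have "(\<integral>x. g x \<partial>zero_measure N p) =
      (\<integral>x. g x \<partial>point_measure {z. poly p z = 0} (\<lambda>z. ennreal (real (order z p) / real N)))"
    unfolding zero_measure_def by (intro integral_distr) (auto simp: measurable_point_measure_eq1)
  also have "\<dots> = (\<Sum>z | poly p z = 0. real (order z p) / real N * g z)"
    using assms(1) by (subst lebesgue_integral_point_measure_finite) (auto simp: poly_roots_finite)
  finally show ?thesis .
qed

lemma integral_semicircle:
  fixes f :: "complex \<Rightarrow> real"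
  assumes "continuous_on UNIV f"
  shows "(\<integral>x. f x \<partial>semicircle) = (\<integral>x. f (of_real x) \<partial>real_semicircle)"
  unfolding semicircle_def real_semicircle_def[symmetric]
  using assms by (intro integral_distr borel_measurable_continuous_onI) auto

text \<open>The quotient of \<open>t ^ i\<close> and \<open>sqrt t ^ k\<close> is the power
  \<open>2 i - k\<close> of \<open>sqrt t\<close>: it decays for \<open>2 i < k\<close>, and for
  \<open>2 i > k\<close> the coefficient is 0. The initial moments enter the limit only through
  \<open>m 0 = 1\<close>, the start of the Catalan recursion; for odd \<open>k\<close> there is no
  diagonal term.\<close>

lemma tendsto_rescaled_moment:
  assumes "m 0 = 1"
  shows "((\<lambda>t. (\<Sum>i\<le>k. moment_coeff m 0 k i * of_real t ^ i) / of_real (sqrt t) ^ k)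
    \<longlongrightarrow> complex_of_real (\<integral>x. x ^ k \<partial>real_semicircle)) at_top"
proof -
  have "((\<lambda>t. \<Sum>i\<le>k. moment_coeff m 0 k i * (of_real t ^ i / of_real (sqrt t) ^ k))
    \<longlongrightarrow> (\<Sum>i\<le>k. if k = 2 * i then moment_coeff m 0 k i else 0)) at_top"
  proof (rule tendsto_sum)
    fix i
    have eq: "\<forall>\<^sub>F t in at_top. complex_of_real (inverse (sqrt t) ^ (k - 2 * i))
        = of_real t ^ i / of_real (sqrt t) ^ k"
      if "2 * i \<le> k"
      using eventually_gt_at_top[of 0]
    proof eventually_elim
      case (elim t)
      have "sqrt t ^ k = (sqrt t ^ 2) ^ i * sqrt t ^ (k - 2 * i)"
        using that by (simp flip: power_mult power_add)
      then have "t ^ i / sqrt t ^ k = inverse (sqrt t) ^ (k - 2 * i)"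
        using elim by (simp add: field_simps)
      then show ?case
        by (metis of_real_divide of_real_power)
    qed
    consider "k < 2 * i" | "k = 2 * i" | "2 * i < k"
      by linarith
    then show "((\<lambda>t. moment_coeff m 0 k i * (of_real t ^ i / of_real (sqrt t) ^ k))
        \<longlongrightarrow> (if k = 2 * i then moment_coeff m 0 k i else 0)) at_top"
    proof cases
      case 1
      then show ?thesis
        by (simp add: moment_coeff_eq_0)
    next
      case 2
      then have "((\<lambda>t. complex_of_real t ^ i / of_real (sqrt t) ^ k) \<longlongrightarrow> 1) at_top"
        using eq by (intro tendsto_eventually) (auto elim: eventually_mono)
      then show ?thesis
        using 2 tendsto_mult_left[of _ 1 at_top "moment_coeff m 0 k i"] by fastforce
    next
      case 3
      have "((\<lambda>t. inverse (sqrt t) ^ (k - 2 * i)) \<longlongrightarrow> 0 ^ (k - 2 * i)) at_top"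
        by (intro tendsto_power tendsto_inverse_0_at_top sqrt_at_top)
      then have "((\<lambda>t. complex_of_real (inverse (sqrt t) ^ (k - 2 * i))) \<longlongrightarrow> of_real 0) at_top"
        using 3 by (intro tendsto_of_real) (simp add: power_0_left)
      then have "((\<lambda>t. complex_of_real t ^ i / of_real (sqrt t) ^ k) \<longlongrightarrow> 0) at_top"
        using eq 3 by (auto elim: Lim_transform_eventually)
      then show ?thesis
        using 3 tendsto_mult_left[of _ 0 at_top "moment_coeff m 0 k i"] by fastforce
    qed
  qed
  moreover have "(\<Sum>i\<le>k. if k = 2 * i then moment_coeff m 0 k i else 0) =
      complex_of_real (\<integral>x. x ^ k \<partial>real_semicircle)"
  proof (cases "even k")
    case True
    then obtain n where k: "k = 2 * n"
      by auto
    have "moment_coeff m 0 (2 * n) n = complex_of_real (\<integral>x. x ^ (2 * n) \<partial>real_semicircle)"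
      by (rule real_semicircle_even_moment[where c = "\<lambda>n. moment_coeff m 0 (2 * n) n"])
        (simp add: assms, rule moment_coeff_diagonal_Suc)
    moreover have "(\<Sum>i\<le>k. if k = 2 * i then moment_coeff m 0 k i else 0) =
        (\<Sum>i\<le>k. if i = n then moment_coeff m 0 k n else 0)"
      by (intro sum.cong) (auto simp: k)
    ultimately show ?thesis
      by (simp add: k)
  next
    case False
    then show ?thesis
      by (subst sum.neutral) (auto simp: real_semicircle_odd_moment)
  qed
  ultimately show ?thesis
    by (simp add: sum_divide_distrib)
qed

theorem theorem2p8:
  fixes d :: nat
    and lam :: "nat \<Rightarrow> complex"
    and \<alpha> :: "nat \<Rightarrow> nat"
    and \<mu> :: "real \<Rightarrow> complex measure"
  assumes "d \<ge> 1"
    and "inj_on lam {1..d}"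
    and "\<And>j. j \<in> {1..d} \<Longrightarrow> \<alpha> j \<ge> 1"
    and "\<And>t. t > 0 \<Longrightarrow> sets (\<mu> t) = sets borel"
    and "\<And>t. t > 0 \<Longrightarrow> prob_space (\<mu> t)"
    and "\<And>t. t > 0 \<Longrightarrow>
           weakly_converges (\<lambda>n. heat_zero_measure d lam \<alpha> n t) (\<mu> t) sequentially"
  shows "weakly_converges (\<lambda>t. distr (\<mu> t) borel (\<lambda>z. z / complex_of_real (sqrt t)))
           semicircle at_top"
  unfolding weakly_converges_def
proof (intro allI impI, elim conjE)
  fix f :: "complex \<Rightarrow> real"
  assume f: "continuous_on UNIV f" "bounded (range f)"
  define A where "A = (\<Sum>j=1..d. \<alpha> j)"
  have "A > 0"
  proof -
    have "\<alpha> 1 \<le> A"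
      unfolding A_def using assms(1) by (intro member_le_sum) auto
    then show ?thesis
      using assms(3)[of 1] assms(1) by simp
  qed
  \<comment> \<open>The strip of the initial zeros depends neither on \<open>n\<close> nor on
    \<open>t\<close>, so division by \<open>sqrt t\<close> makes its width arbitrarily
    small.\<close>
  define B where "B = (\<Sum>j=1..d. \<bar>Im (lam j)\<bar>)"
  \<comment> \<open>The \<open>n\<close>-th power multiplies all multiplicities and the degree by
    \<open>n\<close>, so these initial moments serve for every \<open>n > 0\<close>; only
    \<open>h = 1 / (A * n)\<close> varies.\<close>
  define m where "m k = (\<Sum>j=1..d. of_nat (\<alpha> j) * lam j ^ k) / of_nat A" for k
  have "m 0 = 1"
  proof -
    have "(\<Sum>j=1..d. of_nat (\<alpha> j)) = (of_nat A :: complex)"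
      by (simp add: A_def)
    then show ?thesis
      using \<open>A > 0\<close> by (simp add: m_def)
  qed
  define p where "p n t = heat_poly d lam \<alpha> n t" for n t
  have base: "base_poly d lam \<alpha> ^ n = (\<Prod>j=1..d. [:- lam j, 1:] ^ (\<alpha> j * n))" for n
    by (simp add: base_poly_def power_mult flip: prod_power_distrib)
  have p_eq: "p n t = exp_deriv2 (- (of_real t / (2 * of_nat (A * n))))
      (\<Prod>j=1..d. [:- lam j, 1:] ^ (\<alpha> j * n))" for n t
    by (simp add: p_def heat_poly_def base A_def mult.assoc)
  have nz: "(\<Prod>j=1..d. [:- lam j, 1:] ^ (\<alpha> j * n)) \<noteq> 0" for n
    by simp
  have p_nz: "p n t \<noteq> 0" for n t
    unfolding p_eq using nz by (rule exp_deriv2_nonzero)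
  have strip: "\<bar>Im z\<bar> \<le> B" if "poly (p n t) z = 0" "t > 0" for n t z
  proof (rule roots_exp_deriv2_strip)
    show "poly (exp_deriv2 (- of_real (t / (2 * real (A * n))))
        (\<Prod>j=1..d. [:- lam j, 1:] ^ (\<alpha> j * n))) z = 0"
      using that(1) by (simp add: p_eq)
    show "\<bar>Im z\<bar> \<le> B" if z: "poly (\<Prod>j=1..d. [:- lam j, 1:] ^ (\<alpha> j * n)) z = 0" for z
    proof -
      obtain j where "j \<in> {1..d}" "z = lam j"
        using z by (auto simp: poly_prod)
      then show ?thesis
        unfolding B_def by (auto intro!: member_le_sum[where f = "\<lambda>j. \<bar>Im (lam j)\<bar>"])
    qed
  qed (use nz that in auto)
  define mom where "mom n t k = (\<Sum>z | poly (p n t) z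
      = 0. of_real (real (order z (p n t)) / real (A * n)) * z ^ k)" for n t k
  have mom: "mom n t k = (\<Sum>i\<le>k. moment_coeff m (1 / of_nat (A * n)) k i * of_real t ^ i)"
      if "n > 0" for n t k
  proof -
    have N: "A * n = (\<Sum>j=1..d. \<alpha> j * n)"
      by (simp add: A_def sum_distrib_right)
    have "(\<lambda>k. (\<Sum>j=1..d. of_nat (\<alpha> j * n) * lam j ^ k) / of_nat (A * n)) = m"
    proof
      fix k
      have "(\<Sum>j=1..d. of_nat (\<alpha> j * n) * lam j ^ k)
          = of_nat n * (\<Sum>j=1..d. of_nat (\<alpha> j) * lam j ^ k)"
        by (simp add: sum_distrib_left mult_ac)
      then show "(\<Sum>j=1..d. of_nat (\<alpha> j * n) * lam j ^ k) / of_nat (A * n) = m k"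
        using that by (simp add: m_def)
    qed
    with power_sum_heat[OF _ N, where l = lam and t = "of_real t" and k = k] that \<open>A > 0\<close>
    have *: "(\<Sum>z | poly (p n t) z = 0. of_nat (order z (p n t)) * z ^ k) =
        of_nat (A * n) * (\<Sum>i\<le>k. moment_coeff m (1 / of_nat (A * n)) k i * of_real t ^ i)"
      by (simp only: p_eq) simp
    have "mom n t k = (\<Sum>z | poly (p n t) z = 0. of_nat (order z (p n t)) * z ^ k) / of_nat (A * n)"
      by (simp add: mom_def sum_divide_distrib)
    then show ?thesis
      unfolding * using that \<open>A > 0\<close> by simp
  qed
  define I where "I = (\<integral>x. f x \<partial>semicircle)"
  show "((\<lambda>t. \<integral>x. f x \<partial>distr (\<mu> t) borel (\<lambda>z. z / complex_of_real (sqrt t))) \<longlongrightarrow> I) at_top"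
  proof (rule tendstoI)
    fix e :: real assume "e > 0"
    \<comment> \<open>Halved because the limit in \<open>n\<close> preserves only a weak
      inequality.\<close>
    define \<delta> where "\<delta> = e / 2"
    have "\<delta> > 0"
      using \<open>e > 0\<close> by (simp add: \<delta>_def)
    show "\<forall>\<^sub>F t in at_top. dist (\<integral>x. f x \<partial>distr (\<mu> t) borel (\<lambda>z. z / complex_of_real (sqrt t))) I
        < e"
    proof (rule method_of_moments_near_real_axis[OF prob_space_real_semicircle sets_real_semicircle
          AE_real_semicircle f \<open>\<delta> > 0\<close>, where 'i = complex])
      fix \<eta> K
      assume "\<eta> > 0" and mm:
        "\<And>S w z. finite S \<Longrightarrow> (\<And>i. i \<in> S \<Longrightarrow> 0 \<le> w i) \<Longrightarrow> sum w S = 1 \<Longrightarrow>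
          (\<And>i. i \<in> S \<Longrightarrow> \<bar>Im (z i)\<bar> \<le> \<eta>) \<Longrightarrow>
          (\<And>k. k \<le> K \<Longrightarrow> cmod ((\<Sum>i\<in>S. of_real (w i) * z i ^ k)
              - of_real (\<integral>x. x ^ k \<partial>real_semicircle)) \<le> \<eta>) \<Longrightarrow>
          \<bar>(\<Sum>i\<in>(S :: complex set). w i * f (z i)) - (\<integral>x. f (of_real x) \<partial>real_semicircle)\<bar> \<le> \<delta>"
      \<comment> \<open>The limit of the \<open>k\<close>-th moment as
        \<open>n \<rightarrow> \<infinity>\<close>. Its rescaled distance to the semicircle moment,
        strictly below \<open>\<eta>\<close> for the finitely many \<open>k \<le> K\<close>, decides
        how large \<open>t\<close> must be; strictness leaves room for finite \<open>n\<close>,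
        chosen large depending on \<open>t\<close>.\<close>
      define lm where "lm t k = (\<Sum>i\<le>k. moment_coeff m 0 k i * of_real t ^ i)" for t :: real and k
      have "\<forall>\<^sub>F t in at_top. dist (lm t k / of_real (sqrt t) ^ k)
          (of_real (\<integral>x. x ^ k \<partial>real_semicircle)) < \<eta>" for k
        using tendstoD[OF tendsto_rescaled_moment[where m = m and k = k, OF \<open>m 0 = 1\<close>] \<open>\<eta> > 0\<close>]
            by (simp add: lm_def)
      then have "\<forall>\<^sub>F t in at_top. \<forall>k\<in>{..K}. dist (lm t k / of_real (sqrt t) ^ k)
          (of_real (\<integral>x. x ^ k \<partial>real_semicircle)) < \<eta>"
        by (intro eventually_ball_finite) auto
      moreover have "((\<lambda>t. B / sqrt t) \<longlongrightarrow> 0) at_top"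
        by (intro tendsto_divide_0[OF tendsto_const] filterlim_at_top_imp_at_infinity sqrt_at_top)
      then have "\<forall>\<^sub>F t in at_top. B / sqrt t < \<eta>"
        using \<open>\<eta> > 0\<close> by (rule order_tendstoD)
      ultimately show "\<forall>\<^sub>F t in at_top. dist
          (\<integral>x. f x \<partial>distr (\<mu> t) borel (\<lambda>z. z / complex_of_real (sqrt t))) I < e"
        using eventually_gt_at_top[of 0]
      proof eventually_elim
        case (elim t)
        define g where "g z = f (z / complex_of_real (sqrt t))" for z
        have g: "continuous_on UNIV g" "bounded (range g)"
          unfolding g_def using elim f(2)
          by (auto intro!: continuous_on_compose2[OF f(1)] continuous_intros elim!: bounded_subset)
        have [measurable_cong]: "sets (\<mu> t) = sets borel"
          using elim(3) by (rule assms(4))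
        have [measurable]: "f \<in> borel_measurable borel"
          using f(1) by (rule borel_measurable_continuous_onI)
        have int_distr: "(\<integral>x. f x \<partial>distr (\<mu> t) borel (\<lambda>z. z / complex_of_real (sqrt t)))
            = (\<integral>z. g z \<partial>\<mu> t)"
          unfolding g_def by (rule integral_distr) measurable
        have lim: "(\<lambda>n. \<integral>z. g z \<partial>heat_zero_measure d lam \<alpha> n t) \<longlonglongrightarrow> (\<integral>z. g z \<partial>\<mu> t)"
          using assms(6)[OF elim(3)] g unfolding weakly_converges_def by blast
        have "(\<lambda>n. 1 / of_nat (A * n) :: complex) \<longlonglongrightarrow> 0"
        proof -
          have "(\<lambda>n. 1 / of_nat A * (1 / of_nat n) :: complex) \<longlonglongrightarrow> 1 / of_nat A * 0"
            by (intro tendsto_intros lim_1_over_n)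
          then show ?thesis
            by simp
        qed
        then have "(\<lambda>n. (\<Sum>i\<le>k. moment_coeff m (1 / of_nat (A * n)) k i * of_real t ^ i)
            / of_real (sqrt t) ^ k)
            \<longlonglongrightarrow> lm t k / of_real (sqrt t) ^ k" for k
          unfolding lm_def using elim(3) by (intro tendsto_intros tendsto_moment_coeff) auto
        then have "(\<lambda>n. dist ((\<Sum>i\<le>k. moment_coeff m (1 / of_nat (A * n)) k i * of_real t ^ i)
            / of_real (sqrt t) ^ k)
            (of_real (\<integral>x. x ^ k \<partial>real_semicircle)))
            \<longlonglongrightarrow> dist (lm t k / of_real (sqrt t) ^ k) (of_real (\<integral>x. x ^ k \<partial>real_semicircle))" for k
          by (intro tendsto_dist tendsto_const)
        then have "\<forall>\<^sub>F n in sequentially. \<forall>k\<in>{..K}.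
            dist ((\<Sum>i\<le>k. moment_coeff m (1 / of_nat (A * n)) k i * of_real t ^ i)
                / of_real (sqrt t) ^ k)
            (of_real (\<integral>x. x ^ k \<partial>real_semicircle)) < \<eta>"
          using elim(1) by (intro eventually_ball_finite ballI order_tendstoD) auto
        then have "\<forall>\<^sub>F n in sequentially. \<bar>(\<integral>z. g z \<partial>heat_zero_measure d lam \<alpha> n t) - I\<bar> \<le> \<delta>"
          using eventually_gt_at_top[of 0]
        proof eventually_elim
          case (elim n)
          note n = elim
          define S where "S = {z. poly (p n t) z = 0}"
          define w where "w z = real (order z (p n t)) / real (A * n)" for z
          have "finite S"
            unfolding S_def using p_nz by (rule poly_roots_finite)
          moreover have "0 \<le> w z" for z
            by (simp add: w_def)
          \<comment> \<open>The total weight is the moment of order 0, which stays equal to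
            \<open>m 0\<close>.\<close>
          moreover have "sum w S = 1"
          proof -
            have "of_real (sum w S) = mom n t 0"
              by (simp add: mom_def w_def S_def)
            also have "\<dots> = 1"
              using \<open>m 0 = 1\<close> n(2) by (simp add: mom)
            finally show ?thesis
              using of_real_eq_1_iff by blast
          qed
          moreover have "\<bar>Im (z / complex_of_real (sqrt t))\<bar> \<le> \<eta>" if "z \<in> S" for z
          proof -
            have "\<bar>Im (z / complex_of_real (sqrt t))\<bar> = \<bar>Im z\<bar> / sqrt t"
              using \<open>0 < t\<close> by simp
            also have "\<dots> \<le> B / sqrt t"
              using strip[of n t z] that \<open>0 < t\<close> by (intro divide_right_mono) (auto simp: S_def)
            finally show ?thesis
              using \<open>B / sqrt t < \<eta>\<close> by simp
          qed
          moreover have "cmod ((\<Sum>z\<in>S. of_real (w z) * (z / complex_of_real (sqrt t)) ^ k)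
              - of_real (\<integral>x. x ^ k \<partial>real_semicircle)) \<le> \<eta>" if "k \<le> K" for k
          proof -
            have "(\<Sum>z\<in>S. of_real (w z) * (z / complex_of_real (sqrt t)) ^ k)
                = mom n t k / of_real (sqrt t) ^ k"
              by (simp add: mom_def w_def S_def power_divide sum_divide_distrib)
            also have "\<dots> = (\<Sum>i\<le>k. moment_coeff m (1 / of_nat (A * n)) k i * of_real t ^ i)
                / of_real (sqrt t) ^ k"
              using n(2) by (simp only: mom)
            finally show ?thesis
              using n(1) that by (simp only: dist_norm[symmetric]) (auto intro: less_imp_le)
          qed
          ultimately have "\<bar>(\<Sum>z\<in>S. w z * f (z / complex_of_real (sqrt t)))
              - (\<integral>x. f (of_real x) \<partial>real_semicircle)\<bar> \<le> \<delta>"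
            by (intro mm)
          moreover have "(\<integral>z. g z \<partial>heat_zero_measure d lam \<alpha> n t) = (\<Sum>z\<in>S. w z * g z)"
            using integral_zero_measure[OF p_nz g(1), of "A * n" n t]
            by (simp only: heat_zero_measure_def A_def[symmetric] p_def[symmetric] S_def w_def)
          ultimately show ?case
            by (simp add: g_def I_def integral_semicircle[OF f(1)])
        qed
        then have "\<bar>(\<integral>z. g z \<partial>\<mu> t) - I\<bar> \<le> \<delta>"
          by (intro tendsto_upperbound[OF tendsto_rabs[OF tendsto_diff[OF lim tendsto_const]]]) auto
        then show ?case
          using \<open>e > 0\<close> by (simp add: int_distr dist_real_def \<delta>_def)
      qed
    qed
  qed
qed

end
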